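(* Let $q$ be odd, let $a\in\mathbb{F}_q$ be such that $T^2+T+a$ is irreducible in $\mathbb{F}_q[T]$, and let $G=\{N\in U(2m+2,\mathbb{F}_q):N^TYN=Y\}$ where $$Y=\begin{pmatrix}0&0&J_m\\ 0&X_2&0\\ J_m&0&0\end{pmatrix},\qquad X_2=\begin{pmatrix}2&1\\ 1&2a\end{pmatrix},$$ a Sylow $p$-subgroup of $O^-(2m+2,q)$. Let $h_1=\sum_{i=1}^{m}x_{2m+3-i}x_i+x_{m+1}^2+x_{m+1}x_{m+2}+ax_{m+2}^2$ and, for $k\ge2$, $$h_k=\sum_{i=1}^{m+1}\left(x_{2m+3-i}^{q^{k-1}}x_i+x_{2m+3-i}x_i^{q^{k-1}}\right)+2\left(x_{m+1}^{q^{k-1}+1}+a\,x_{m+2}^{q^{k-1}+1}\right).$$ Then the invariant field $\mathbb{F}_q(V)^G$ is generated by the polynomials $N(x_i)$, $i=1,\dots,m+2$, and $h_j$, $j=1,\dots,m$; i.e. $$\mathbb{F}_q(V)^G=\mathbb{F}_q(x_1,N(x_2),\dots,N(x_{m+2}),h_1,\dots,h_m).$$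
   Context: $q$ is a power of a prime $p$, $m\ge 1$, $V=\mathbb{F}_q^{2m+2}$ (column vectors) with $x_1,\dots,x_{2m+2}$ the dual basis of the standard basis; $\mathbb{F}_q[V]=\mathbb{F}_q[x_1,\dots,x_{2m+2}]$, $\mathbb{F}_q(V)$ is its fraction field, and $G$ acts by $(g\cdot f)(v)=f(g^{-1}v)$. $N(x_i)=\prod_{y\in G\cdot x_i}y$ is the product over the $G$-orbit of $x_i$ (so $N(x_1)=x_1$). $U(n,\mathbb{F})$ is the group of lower triangular $n\times n$ matrices over $\mathbb{F}$ with ones on the diagonal; $J_m$ is the $m\times m$ matrix with ones on the antidiagonal and zeros elsewhere. $O^-(2m+2,q)$ is the group of invertible matrices preserving the quadratic form $h_1$ on $V$. *)

theory Defs
  imports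
    "HOL-Library.Cardinality"
    "HOL-Library.Poly_Mapping"
    "HOL-Computational_Algebra.Computational_Algebra"
    "HOL-Algebra.Generated_Fields"
    "HOL-Algebra.Algebraic_Closure_Type"
    "Jordan_Normal_Form.Matrix"
    "Jordan_Normal_Form.Gauss_Jordan_Elimination"
begin

text \<open>
  Polynomials in the variables \<open>x\<^sub>0, x\<^sub>1, x\<^sub>2, \<dots>\<close>: finitely supported functions from
  exponent vectors to coefficients, with the convolution product of \<open>Poly_Mapping\<close>.
  The ring \<open>\<bbbF>\<^sub>q[V]\<close> for \<open>dim V = n\<close> is the subset of polynomials that involve only
  \<open>x\<^sub>1, \<dots>, x\<^sub>n\<close>, and \<open>\<bbbF>\<^sub>q(V)\<close> is its field of fractions.
\<close>

type_synonym 'a mpoly = "(nat \<Rightarrow>\<^sub>0 nat) \<Rightarrow>\<^sub>0 'a"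

definition Const :: "'a::field \<Rightarrow> 'a mpoly" where
  "Const c = Poly_Mapping.single 0 c"

definition Var :: "nat \<Rightarrow> 'a::field mpoly" where
  "Var i = Poly_Mapping.single (Poly_Mapping.single i 1) 1"

definition coord_ring :: "nat \<Rightarrow> 'a::field mpoly set" where
  "coord_ring n = {f. \<forall>\<mu>\<in>Poly_Mapping.keys f. Poly_Mapping.keys \<mu> \<subseteq> {1..n}}"

definition fun_field :: "nat \<Rightarrow> 'a::field mpoly fract set" where
  "fun_field n = {Fract f g | f g. f \<in> coord_ring n \<and> g \<in> coord_ring n \<and> g \<noteq> 0}"

definition subst :: "(nat \<Rightarrow> 'a::field mpoly) \<Rightarrow> 'a mpoly \<Rightarrow> 'a mpoly" where
  "subst s f = (\<Sum>\<mu>\<in>Poly_Mapping.keys f. Const (Poly_Mapping.lookup f \<mu>) *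
     (\<Prod>i\<in>Poly_Mapping.keys \<mu>. s i ^ Poly_Mapping.lookup \<mu> i))"

text \<open>
  The action \<open>(g \<cdot> f)(v) = f(g\<^sup>-\<^sup>1 v)\<close> of an invertible matrix on polynomials: the coordinate
  function \<open>x\<^sub>i\<close> is sent to the linear form given by row \<open>i\<close> of \<open>g\<^sup>-\<^sup>1\<close>. Coordinates are numbered
  from 1, matrix entries from 0. The variables other than \<open>x\<^sub>1, \<dots>, x\<^sub>n\<close> are left fixed, so an
  invertible \<open>g\<close> acts by an automorphism of the ring of all polynomials.
\<close>

definition act_var :: "'a::field mat \<Rightarrow> nat \<Rightarrow> 'a mpoly" where
  "act_var g i = (if i \<in> {1..dim_row g}
     then \<Sum>j = 1..dim_row g. Const (the (mat_inverse g) $$ (i - 1, j - 1)) * Var j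
     else Var i)"

definition act :: "'a::field mat \<Rightarrow> 'a mpoly \<Rightarrow> 'a mpoly" where
  "act g f = subst (act_var g) f"

text \<open>
  The induced action on fractions; for invertible \<open>g\<close> the value does not depend on the
  representation of the fraction, since \<open>act g\<close> is then a ring automorphism.
\<close>

definition act_fract :: "'a::field mat \<Rightarrow> 'a mpoly fract \<Rightarrow> 'a mpoly fract" where
  "act_fract g F = (THE H. \<exists>f1 f2. f2 \<noteq> 0 \<and> F = Fract f1 f2 \<and> H = Fract (act g f1) (act g f2))"

definition invariant_field :: "nat \<Rightarrow> 'a::field mat set \<Rightarrow> 'a mpoly fract set" where
  "invariant_field n G = {F \<in> fun_field n. \<forall>g\<in>G. act_fract g F = F}"

definition orbit_norm :: "'a::field mat set \<Rightarrow> nat \<Rightarrow> 'a mpoly" where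
  "orbit_norm G i = (\<Prod>y\<in>(\<lambda>g. act g (Var i)) ` G. y)"

text \<open>
  The field \<open>\<bbbF>\<^sub>q(S)\<close> generated by a set of polynomials, with the constants adjoined explicitly.
\<close>

definition field_gen :: "'a::field mpoly set \<Rightarrow> 'a mpoly fract set" where
  "field_gen S = generate_field ring_of_type_algebra (to_fract ` (range Const \<union> S))"

definition unitriangular :: "nat \<Rightarrow> 'a::field mat set" where
  "unitriangular n = {N \<in> carrier_mat n n.
     (\<forall>i<n. N $$ (i, i) = 1) \<and> (\<forall>i<n. \<forall>j<n. i < j \<longrightarrow> N $$ (i, j) = 0)}"

definition antidiag :: "nat \<Rightarrow> 'a::field mat" where
  "antidiag m = mat m m (\<lambda>(i, j). if i + j + 1 = m then 1 else 0)"

definition X2 :: "'a::field \<Rightarrow> 'a mat" where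
  "X2 a = mat_of_rows_list 2 [[2, 1], [1, 2 * a]]"

text \<open>
  The \<open>3 \<times> 3\<close> block matrix with block sizes \<open>m, 2, m\<close>, assembled from the upper left
  block of size \<open>m + 2\<close> and the remaining last block row and column.
\<close>

definition Y_form :: "nat \<Rightarrow> 'a::field \<Rightarrow> 'a mat" where
  "Y_form m a = four_block_mat
     (four_block_mat (0\<^sub>m m m) (0\<^sub>m m 2) (0\<^sub>m 2 m) (X2 a))
     (antidiag m @\<^sub>r 0\<^sub>m 2 m)
     (four_block_mat (antidiag m) (0\<^sub>m m 2) (0\<^sub>m 0 m) (0\<^sub>m 0 2))
     (0\<^sub>m m m)"

definition orth_unitriangular :: "nat \<Rightarrow> 'a::field \<Rightarrow> 'a mat set" where
  "orth_unitriangular m a = {N \<in> unitriangular (2 * m + 2). N\<^sup>T * Y_form m a * N = Y_form m a}"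

definition h :: "nat \<Rightarrow> nat \<Rightarrow> 'a::field \<Rightarrow> nat \<Rightarrow> 'a mpoly" where
  "h q m a k = (if k = 1 then
       (\<Sum>i = 1..m. Var (2 * m + 3 - i) * Var i)
       + Var (m + 1) ^ 2 + Var (m + 1) * Var (m + 2) + Const a * Var (m + 2) ^ 2
     else
       (\<Sum>i = 1..m + 1. Var (2 * m + 3 - i) ^ (q ^ (k - 1)) * Var i
                       + Var (2 * m + 3 - i) * Var i ^ (q ^ (k - 1)))
       + 2 * (Var (m + 1) ^ (q ^ (k - 1) + 1) + Const a * Var (m + 2) ^ (q ^ (k - 1) + 1)))"

end

theory Submission
  imports Defs "Jordan_Normal_Form.Determinant"
begin

text \<open>
  Let \<open>L\<close> be the field generated by the norms and the \<open>h\<^sub>k\<close>, put \<open>n = 2m + 2\<close> and adjoin \<open>x\<^sub>1, \<dots>, x\<^sub>n\<close> to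
  \<open>L\<close> one after the other. With \<open>d(s) = min (s - 1) (n - s)\<close>, Eichler transformations show that the
  stabilizer of \<open>x\<^sub>1, \<dots>, x\<^sub>s\<^sub>-\<^sub>1\<close> in \<open>G\<close> moves \<open>x\<^sub>s\<close> to all of \<open>x\<^sub>s + \<langle>x\<^sub>1, \<dots>, x\<^bsub>d(s)\<^esub>\<rangle>\<close>, so \<open>x\<^sub>s\<close> has at least
  \<open>q\<^bsup>d(s)\<^esup>\<close> conjugates. On the other hand \<open>x\<^sub>s\<close> is a root of a monic polynomial of exactly this degree
  over \<open>L[x\<^sub>1, \<dots>, x\<^sub>s\<^sub>-\<^sub>1]\<close>, namely \<open>\<phi>(T) - \<phi>(x\<^sub>s)\<close>, where \<open>\<phi>\<close> is the additive polynomial with root space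
  \<open>\<langle>x\<^sub>1, \<dots>, x\<^bsub>d(s)\<^esub>\<rangle>\<close>: for \<open>s \<le> m + 2\<close> the value \<open>\<phi>(x\<^sub>s)\<close> is \<open>N(x\<^sub>s)\<close>, and for larger \<open>s\<close> it is found by
  evaluating the bilinear form at \<open>(\<phi>(x\<^sub>1), \<dots>, \<phi>(x\<^sub>n))\<close>. Hence an invariant in
  \<open>L[x\<^sub>1, \<dots>, x\<^sub>s]\<close> already lies in \<open>L[x\<^sub>1, \<dots>, x\<^sub>s\<^sub>-\<^sub>1]\<close>, and by descent in \<open>L\<close>.
\<close>


section \<open>Finite fields\<close>

text \<open>For nonzero \<open>c\<close>, multiplication by \<open>c\<close> permutes the nonzero
  elements, so the factor c^(q-1) does not change their product.\<close>

lemma finite_field_power_CARD: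
  fixes c :: "'a::{field,finite}"
  shows "c ^ CARD('a) = c"
proof (cases "c = 0")
  case False
  have "c * (\<Prod>y\<in>UNIV-{0}. c * y) = c * c ^ (CARD('a) - 1) * \<Prod>(UNIV-{0})"
    by (simp add: prod.distrib mult_ac)
  also have "c * c ^ (CARD('a) - 1) = c ^ Suc (CARD('a) - 1)"
    by (subst power_Suc) auto
  also have "Suc (CARD('a) - 1) = CARD('a)"
    using finite_UNIV_card_ge_0[where ?'a = 'a] by simp
  also have "(\<Prod>y\<in>UNIV-{0}. c * y) = (\<Prod>y\<in>UNIV-{0}. y)"
    by (rule prod.reindex_bij_witness[of _ "\<lambda>y. y / c" "\<lambda>y. c * y"]) (use False in auto)
  finally show ?thesis by simp
qed (use finite_UNIV_card_ge_0[where ?'a = 'a] in auto)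

lemma card_field_gt_1: "CARD('a::{field,finite}) > 1"
proof -
  have "card {0, 1::'a} \<le> CARD('a)" by (rule card_mono) auto
  then show ?thesis by simp
qed

text \<open>Translation by 1 permutes the field, so the sum of all elements absorbs the additional
  summand q * 1.\<close>

lemma of_nat_CARD_field: "of_nat CARD('a::{field,finite}) = (0::'a)"
proof -
  have "(\<Sum>c\<in>(UNIV::'a set). c + 1) = (\<Sum>c\<in>UNIV. c)"
    by (rule sum.reindex_bij_witness[of _ "\<lambda>c. c - 1" "\<lambda>c. c + 1"]) auto
  then show ?thesis by (simp add: sum.distrib)
qed

lemma two_neq_0_if_odd_CARD:
  assumes "odd CARD('a::{field,finite})"
  shows "(2::'a) \<noteq> 0"
proof
  assume 2: "(2::'a) = 0"
  obtain k where "CARD('a) = 2 * k + 1" using assms by (elim oddE)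
  then have "(of_nat CARD('a) :: 'a) = 2 * of_nat k + 1" by simp
  with 2 show False by (simp add: of_nat_CARD_field)
qed

text \<open>The polynomial \<open>(T + 1)\<^sup>q - T\<^sup>q - 1\<close> has degree below \<open>q\<close> and vanishes on the whole field;
  this gives the additivity of the \<open>q\<close>-th power without knowing that \<open>q\<close> is a prime power.\<close>

lemma of_nat_CARD_choose_field:
  assumes "0 < i" "i < CARD('a::{field,finite})"
  shows "of_nat (CARD('a) choose i) = (0::'a)"
proof -
  let ?q = "CARD('a)"
  define P :: "'a poly" where "P = (\<Sum>i\<in>{1..<?q}. monom (of_nat (?q choose i)) i)"
  have q: "?q \<ge> 1" using card_field_gt_1[where 'a='a] by simp
  have "poly P c = 0" for c
  proof -
    have "{..?q} = insert 0 (insert ?q {1..<?q})" using q by auto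
    then have "(c + 1) ^ ?q = 1 + c ^ ?q + poly P c"
      using q by (simp add: binomial_ring P_def poly_sum poly_monom)
    then show ?thesis by (simp add: finite_field_power_CARD)
  qed
  moreover have "degree P < ?q"
  proof -
    have "degree P \<le> ?q - 1" unfolding P_def
      by (rule degree_sum_le) (auto intro: order.trans[OF degree_monom_le])
    then show ?thesis using q by linarith
  qed
  ultimately have "P = 0"
    using card_poly_roots_bound[of P] by auto
  moreover have "coeff P i = of_nat (?q choose i)"
    using assms by (simp add: P_def coeff_sum)
  ultimately show ?thesis by simp
qed

text \<open>The field of constants inside a larger field. Later \<open>\<iota>\<close> becomes
  \<open>emb\<close>, and the larger field is the type of all fractions of polynomials.\<close>

locale finite_field_embedding = field_hom \<iota> for \<iota> :: "'a::{field,finite} \<Rightarrow> 'b::field" +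
  fixes q :: nat
  assumes q_eq: "q = CARD('a)"
begin

lemma q_gt_1: "q > 1" unfolding q_eq by (rule card_field_gt_1)

text \<open>The inner binomial coefficients vanish in the finite field, and \<open>\<iota>\<close>
  carries this to the larger one.\<close>

lemma frobenius_add: "(x + y) ^ q = x ^ q + (y::'b) ^ q"
proof -
  have "{..q} = insert 0 (insert q {1..<q})" using q_gt_1 by auto
  moreover have "of_nat (q choose i) = (0::'b)" if "i \<in> {1..<q}" for i
  proof -
    have "of_nat (q choose i) = \<iota> (of_nat (q choose i))" by (simp add: hom_distribs)
    also have "\<dots> = 0" using of_nat_CARD_choose_field[where 'a='a, of i] that by (simp add: q_eq)
    finally show ?thesis .
  qed
  ultimately show ?thesis using q_gt_1 by (simp add: binomial_ring add.commute)
qed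

lemma frobenius_iter_add: "(x + y) ^ (q ^ j) = x ^ (q ^ j) + (y::'b) ^ (q ^ j)"
  by (induction j) (simp_all add: power_mult mult.commute[of q] frobenius_add)

lemma frobenius_iter_sum: "(\<Sum>i\<in>I. f i) ^ (q ^ j) = (\<Sum>i\<in>I. (f i :: 'b) ^ (q ^ j))"
  using q_gt_1 by (induction I rule: infinite_finite_induct) (simp_all add: frobenius_iter_add zero_power)

lemma embedding_power_q: "\<iota> c ^ q = \<iota> c"
  by (metis hom_power finite_field_power_CARD q_eq)

lemma embedding_power_q_iter: "\<iota> c ^ (q ^ j) = \<iota> c"
  by (induction j) (simp_all add: power_mult embedding_power_q)

text \<open>Homogeneous form of the factorization of T^q - T into the linear factors T - c. For
  nonzero \<open>t\<close> it is that factorization at s/t, multiplied by t^q.\<close>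

lemma prod_diff_embedding: "(\<Prod>c\<in>UNIV. s - \<iota> c * t) = s ^ q - t ^ (q - 1) * s"
proof (cases "t = 0")
  case True
  then show ?thesis using q_gt_1 by (simp add: zero_power flip: q_eq)
next
  case False
  define P :: "'b poly" where "P = (\<Prod>c\<in>UNIV. [:- \<iota> c, 1:])"
  define R :: "'b poly" where "R = monom 1 q - monom 1 1"
  have P: "degree P = q" unfolding P_def
    by (simp add: degree_prod_eq_sum_degree q_eq)
  have P1: "lead_coeff P = 1" unfolding P_def lead_coeff_prod by simp
  have R: "degree R = q" "lead_coeff R = 1"
  proof -
    have "degree (monom (1::'b) 1) < degree (monom (1::'b) q)" using q_gt_1 by (simp add: degree_monom_eq)
    then show "degree R = q" unfolding R_def using degree_add_eq_left[of "- monom (1::'b) 1" "monom 1 q"]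
      by (simp add: degree_monom_eq)
    then show "lead_coeff R = 1" using q_gt_1 by (simp add: R_def)
  qed
  \<comment> \<open>Both are monic of degree \<open>q\<close>, so their difference has smaller
    degree; yet it vanishes at the \<open>q\<close> points of the range of
    \<open>\<iota>\<close>.\<close>
  have "P = R"
  proof (rule ccontr)
    assume "P \<noteq> R"
    then have ne: "P - R \<noteq> 0" by simp
    have "degree (P - R) < q"
    proof (rule ccontr)
      assume a: "\<not> degree (P - R) < q"
      have "degree (P - R) \<le> q" using P R by (intro degree_diff_le) auto
      then have "degree (P - R) = q" using a by simp
      then have "lead_coeff (P - R) = 0" using P P1 R by simp
      then show False using ne by (simp only: leading_coeff_0_iff)
    qed
    moreover have "\<iota> ` UNIV \<subseteq> {x. poly (P - R) x = 0}"
    proof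
      fix x assume "x \<in> \<iota> ` UNIV"
      then obtain c where c: "x = \<iota> c" by auto
      have "poly P x = 0" unfolding P_def poly_prod by (rule prod_zero) (auto simp: c)
      moreover have "poly R x = 0" by (simp add: R_def poly_monom c embedding_power_q)
      ultimately show "x \<in> {x. poly (P - R) x = 0}" by simp
    qed
    then have "card (range \<iota>) \<le> card {x. poly (P - R) x = 0}"
      by (intro card_mono poly_roots_finite ne)
    moreover have "card (range \<iota>) = q" unfolding q_eq by (intro card_image injI) simp
    ultimately show False using card_poly_roots_bound[OF ne] by linarith
  qed
  then have "poly P (s / t) = poly R (s / t)" by simp
  then have *: "(\<Prod>c\<in>UNIV. s / t - \<iota> c) = (s / t) ^ q - s / t"
    by (simp add: P_def R_def poly_prod poly_monom)
  have "(\<Prod>c\<in>UNIV. s - \<iota> c * t) = (\<Prod>c\<in>(UNIV::'a set). t * (s / t - \<iota> c))"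
    by (rule prod.cong) (use False in \<open>auto simp: field_simps\<close>)
  also have "\<dots> = t ^ q * ((s / t) ^ q - s / t)" by (simp only: prod.distrib * prod_constant q_eq)
  also have "t ^ q * ((s / t) ^ q - s / t) = (t * (s / t)) ^ q - t ^ q * (s / t)"
    by (simp only: right_diff_distrib power_mult_distrib)
  also have "t ^ q = t ^ (q - 1) * t"
    using power_minus_mult[of q t] q_gt_1 by simp
  also have "t ^ (q - 1) * t * (s / t) = t ^ (q - 1) * s" using False by simp
  also have "t * (s / t) = s" using False by simp
  finally show ?thesis .
qed

end

section \<open>Subrings and integral extensions\<close>

text \<open>Subrings are plain sets, so that polynomials over the whole type can be used while
  membership of their coefficients is tracked separately.\<close>

definition subring_set :: "'b::comm_ring_1 set \<Rightarrow> bool" where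
  "subring_set A \<longleftrightarrow> 1 \<in> A \<and> (\<forall>x\<in>A. \<forall>y\<in>A. x - y \<in> A \<and> x * y \<in> A)"

lemma subring_set_closed:
  assumes "subring_set A"
  shows "0 \<in> A" "1 \<in> A" "x \<in> A \<Longrightarrow> y \<in> A \<Longrightarrow> x + y \<in> A" "x \<in> A \<Longrightarrow> - x \<in> A"
    "x \<in> A \<Longrightarrow> y \<in> A \<Longrightarrow> x - y \<in> A" "x \<in> A \<Longrightarrow> y \<in> A \<Longrightarrow> x * y \<in> A" "x \<in> A \<Longrightarrow> x ^ n \<in> A"
    "(\<And>i. i \<in> I \<Longrightarrow> f i \<in> A) \<Longrightarrow> sum f I \<in> A" "(\<And>i. i \<in> I \<Longrightarrow> f i \<in> A) \<Longrightarrow> prod f I \<in> A"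
    "numeral w \<in> A"
proof -
  note d = assms[unfolded subring_set_def]
  show 1: "1 \<in> A" using d by auto
  show 0: "0 \<in> A" using d 1 by (metis diff_self)
  show neg: "- x \<in> A" if "x \<in> A" for x using d 0 that by (metis diff_0)
  show add: "x + y \<in> A" if "x \<in> A" "y \<in> A" for x y using d neg[OF that(2)] that(1) by (metis diff_minus_eq_add)
  show "x \<in> A \<Longrightarrow> y \<in> A \<Longrightarrow> x - y \<in> A" using d by auto
  show mul: "x \<in> A \<Longrightarrow> y \<in> A \<Longrightarrow> x * y \<in> A" for x y using d by auto
  show "x \<in> A \<Longrightarrow> x ^ n \<in> A" by (induction n) (auto intro: 1 mul)
  show "(\<And>i. i \<in> I \<Longrightarrow> f i \<in> A) \<Longrightarrow> sum f I \<in> A"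
    by (induction I rule: infinite_finite_induct) (auto intro: 0 add)
  show "(\<And>i. i \<in> I \<Longrightarrow> f i \<in> A) \<Longrightarrow> prod f I \<in> A"
    by (induction I rule: infinite_finite_induct) (auto intro: 1 mul)
  have "of_nat k \<in> A" for k by (induction k) (auto intro: 0 1 add)
  then show "numeral w \<in> A" by (metis of_nat_numeral)
qed

definition adjoin :: "'b::comm_ring_1 set \<Rightarrow> 'b \<Rightarrow> 'b set" where
  "adjoin A \<theta> = {poly r \<theta> | r. \<forall>i. coeff r i \<in> A}"

lemma adjoin_superset:
  assumes "subring_set A"
  shows "A \<subseteq> adjoin A \<theta>" "\<theta> \<in> adjoin A \<theta>"
proof -
  note cl = subring_set_closed[OF assms]
  have "poly [:c:] \<theta> \<in> adjoin A \<theta>" if "c \<in> A" for c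
    unfolding adjoin_def using that cl by (intro CollectI exI[of _ "[:c:]"]) (auto simp: coeff_pCons split: nat.split)
  then show "A \<subseteq> adjoin A \<theta>" by auto
  have "poly [:0,1:] \<theta> \<in> adjoin A \<theta>"
    unfolding adjoin_def using cl by (intro CollectI exI[of _ "[:0,1:]"]) (auto simp: coeff_pCons split: nat.split)
  then show "\<theta> \<in> adjoin A \<theta>" by simp
qed

lemma subring_set_adjoin:
  assumes "subring_set A"
  shows "subring_set (adjoin A \<theta>)"
  unfolding subring_set_def
proof (intro conjI ballI)
  note cl = subring_set_closed[OF assms]
  show "1 \<in> adjoin A \<theta>" using adjoin_superset[OF assms] cl by auto
  fix x y assume "x \<in> adjoin A \<theta>" "y \<in> adjoin A \<theta>"
  then obtain r s where rs: "x = poly r \<theta>" "y = poly s \<theta>" "\<And>i. coeff r i \<in> A" "\<And>i. coeff s i \<in> A"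
    unfolding adjoin_def by auto
  show "x - y \<in> adjoin A \<theta>" unfolding adjoin_def
    using rs cl by (intro CollectI exI[of _ "r - s"]) auto
  show "x * y \<in> adjoin A \<theta>" unfolding adjoin_def
    using rs cl by (intro CollectI exI[of _ "r * s"]) (auto simp: coeff_mult intro!: cl(8))
qed

text \<open>Division with remainder by a monic polynomial never divides in \<open>A\<close>, so a
  subring suffices.\<close>

lemma adjoin_monic_root_reduce:
  assumes A: "subring_set A" and P: "lead_coeff P = 1" "\<And>i. coeff P i \<in> A" "poly P \<theta> = 0"
    and f: "f \<in> adjoin A \<theta>"
  shows "\<exists>r. (\<forall>i. coeff r i \<in> A) \<and> f = poly r \<theta> \<and> (degree r < degree P \<or> r = 0)"
proof -
  note cl = subring_set_closed[OF A]
  obtain r where "f = poly r \<theta>" "\<forall>i. coeff r i \<in> A" using f unfolding adjoin_def by auto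
  then show ?thesis
  proof (induction "degree r" arbitrary: r rule: less_induct)
    case less
    show ?case
    proof (cases "degree r < degree P \<or> r = 0")
      case True
      then show ?thesis using less by auto
    next
      case False
      define k where "k = degree r - degree P"
      \<comment> \<open>Subtracting this multiple of \<open>P\<close> cancels the leading term of
        \<open>r\<close> and keeps the value at \<open>\<theta>\<close>, which is a root of
        \<open>P\<close>.\<close>
      define s where "s = r - monom (lead_coeff r) k * P"
      have "f = poly s \<theta>" using less P by (simp add: s_def)
      moreover have sA: "\<forall>i. coeff s i \<in> A"
        using less.prems P cl by (auto simp: s_def coeff_monom_mult)
      moreover have "degree s < degree r \<or> s = 0"
      proof (cases "s = 0")
        case False
        have "P \<noteq> 0" using P(1) by auto
        have deg: "degree (monom (lead_coeff r) k * P) \<le> degree r"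
          using \<open>\<not> (degree r < degree P \<or> r = 0)\<close>
          by (intro order.trans[OF degree_mult_le] order.trans[OF add_right_mono[OF degree_monom_le]]) (simp add: k_def)
        then have "degree s \<le> degree r" unfolding s_def by (intro degree_diff_le) auto
        moreover have "coeff s (degree r) = 0"
          using \<open>\<not> (degree r < degree P \<or> r = 0)\<close> P(1) by (simp add: s_def k_def coeff_monom_mult)
        ultimately show ?thesis using False by (metis le_neq_implies_less leading_coeff_0_iff)
      qed simp
      ultimately show ?thesis using less.hyps[of s] by auto
    qed
  qed
qed

text \<open>A polynomial of degree below \<open>d\<close> representing \<open>f\<close> takes the value \<open>f\<close> at \<open>d\<close> conjugates
  of \<open>\<theta>\<close>, hence is constant.\<close>

lemma fixed_in_adjoin_descends:
  fixes \<theta> f :: "'b::idom"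
  assumes A: "subring_set A" and P: "lead_coeff P = 1" "\<And>i. coeff P i \<in> A" "poly P \<theta> = 0"
    and f: "f \<in> adjoin A \<theta>"
    and hom: "\<And>\<sigma>. \<sigma> \<in> S \<Longrightarrow> comm_ring_hom \<sigma>"
    and fixA: "\<And>\<sigma> x. \<sigma> \<in> S \<Longrightarrow> x \<in> A \<Longrightarrow> \<sigma> x = x"
    and fixf: "\<And>\<sigma>. \<sigma> \<in> S \<Longrightarrow> \<sigma> f = f"
    and fin: "finite D" "D \<subseteq> (\<lambda>\<sigma>. \<sigma> \<theta>) ` S" and card: "degree P \<le> card D"
  shows "f \<in> A"
proof -
  obtain r where r: "\<forall>i. coeff r i \<in> A" "f = poly r \<theta>" "degree r < degree P \<or> r = 0"
    using adjoin_monic_root_reduce[OF A P f] by auto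
  have "poly r x = f" if xD: "x \<in> D" for x
  proof -
    obtain \<sigma> where \<sigma>: "\<sigma> \<in> S" "x = \<sigma> \<theta>" using fin(2) xD by blast
    interpret comm_ring_hom \<sigma> by (rule hom[OF \<sigma>(1)])
    have "map_poly \<sigma> r = r" by (rule poly_eqI) (use r fixA[OF \<sigma>(1)] in \<open>simp add: coeff_map_poly\<close>)
    have "\<sigma> (poly p \<theta>) = poly (map_poly \<sigma> p) (\<sigma> \<theta>)" for p
      by (induction p) (simp_all add: hom_distribs map_poly_pCons)
    then have "\<sigma> f = poly r x" using \<open>map_poly \<sigma> r = r\<close> \<sigma> r by metis
    then show ?thesis using fixf[OF \<sigma>(1)] by simp
  qed
  then have sub: "D \<subseteq> {x. poly (r - [:f:]) x = 0}" by auto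
  have "degree (r - [:f:]) \<le> degree r" by (intro degree_diff_le) auto
  have "r = [:f:]"
  proof (cases "r = 0")
    case True
    then show ?thesis using r by simp
  next
    case False
    show ?thesis
    proof (rule ccontr)
      assume "r \<noteq> [:f:]"
      then have ne: "r - [:f:] \<noteq> 0" by simp
      have "card D \<le> card {x. poly (r - [:f:]) x = 0}"
        by (intro card_mono poly_roots_finite ne sub)
      then show False
        using card_poly_roots_bound[OF ne] \<open>degree (r - [:f:]) \<le> degree r\<close> r(3) card False by linarith
    qed
  qed
  then have "f = coeff r 0" by simp
  then show ?thesis using r(1) by metis
qed


section \<open>Additive polynomials attached to a flag of subspaces\<close>

text \<open>For independent x_1, ..., x_r this is the additive polynomial whose roots form their
  span over F_q. The recursion multiplies the values at t - c x_{r+1} over all constants c; by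
  additivity and \<open>prod_diff_embedding\<close> the product collapses to two terms.\<close>

primrec span_poly :: "nat \<Rightarrow> (nat \<Rightarrow> 'b::field) \<Rightarrow> nat \<Rightarrow> 'b \<Rightarrow> 'b" where
  "span_poly q x 0 t = t"
| "span_poly q x (Suc r) t =
     span_poly q x r t ^ q - span_poly q x r (x (Suc r)) ^ (q - 1) * span_poly q x r t"

text \<open>The span over F_q of the first \<open>r\<close> generators, enlarged by one generator at
  a time in step with \<open>span_poly\<close>.\<close>

primrec span_set :: "('a \<Rightarrow> 'b::field) \<Rightarrow> (nat \<Rightarrow> 'b) \<Rightarrow> nat \<Rightarrow> 'b set" where
  "span_set \<iota> x 0 = {0}"
| "span_set \<iota> x (Suc r) = (\<lambda>(u, c). u + \<iota> c * x (Suc r)) ` (span_set \<iota> x r \<times> UNIV)"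

context finite_field_embedding
begin

lemma zero_in_span_set: "0 \<in> span_set \<iota> x r"
  by (induction r) (auto intro!: image_eqI[of _ _ "(0, 0)"])

lemma span_set_add: "u \<in> span_set \<iota> x r \<Longrightarrow> v \<in> span_set \<iota> x r \<Longrightarrow> u + v \<in> span_set \<iota> x r"
proof (induction r arbitrary: u v)
  case (Suc r)
  then obtain u' c v' d where "u = u' + \<iota> c * x (Suc r)" "v = v' + \<iota> d * x (Suc r)"
    "u' \<in> span_set \<iota> x r" "v' \<in> span_set \<iota> x r" by auto
  then show ?case using Suc.IH[of u' v']
    by (auto intro!: image_eqI[of _ _ "(u' + v', c + d)"] simp: algebra_simps hom_distribs)
qed simp

lemma span_set_scale: "u \<in> span_set \<iota> x r \<Longrightarrow> \<iota> c * u \<in> span_set \<iota> x r"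
proof (induction r arbitrary: u)
  case (Suc r)
  then obtain u' d where "u = u' + \<iota> d * x (Suc r)" "u' \<in> span_set \<iota> x r" by auto
  then show ?case using Suc.IH[of u']
    by (auto intro!: image_eqI[of _ _ "(\<iota> c * u', c * d)"] simp: algebra_simps hom_distribs)
qed simp

lemma span_set_uminus: "u \<in> span_set \<iota> x r \<Longrightarrow> - u \<in> span_set \<iota> x r"
  using span_set_scale[of u x r "- 1"] by (simp add: hom_distribs)

lemma span_set_mono: "r \<le> s \<Longrightarrow> span_set \<iota> x r \<subseteq> span_set \<iota> x s"
proof (induction rule: dec_induct)
  case (step n)
  have "span_set \<iota> x n \<subseteq> span_set \<iota> x (Suc n)"
    by (auto intro!: image_eqI[of _ _ "(_, 0)"])
  then show ?case using step.IH by blast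
qed simp

lemma generator_in_span_set:
  assumes "1 \<le> i" "i \<le> r" shows "x i \<in> span_set \<iota> x r"
proof -
  obtain k where k: "i = Suc k" using assms by (cases i) auto
  have "x i \<in> span_set \<iota> x i" unfolding k
    by (auto intro!: image_eqI[of _ _ "(0, 1)"] zero_in_span_set)
  then show ?thesis using span_set_mono[OF assms(2)] by auto
qed

lemma sum_in_span_set: "(\<And>i. i \<in> I \<Longrightarrow> f i \<in> span_set \<iota> x r) \<Longrightarrow> sum f I \<in> span_set \<iota> x r"
  by (induction I rule: infinite_finite_induct) (auto intro: zero_in_span_set span_set_add)

lemma span_set_induct [consumes 1, case_names zero gen add]:
  assumes "u \<in> span_set \<iota> x r" "P 0" "\<And>c i. 1 \<le> i \<Longrightarrow> i \<le> r \<Longrightarrow> P (\<iota> c * x i)"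
    "\<And>u v. P u \<Longrightarrow> P v \<Longrightarrow> P (u + v)"
  shows "P u"
  using assms
proof (induction r arbitrary: u)
  case (Suc r)
  then obtain u' d where "u = u' + \<iota> d * x (Suc r)" "u' \<in> span_set \<iota> x r" by auto
  then show ?case using Suc by auto
qed simp

lemma finite_span_set: "finite (span_set \<iota> x r)"
  by (induction r) auto

lemma span_poly_add: "span_poly q x r (s + t :: 'b) = span_poly q x r s + span_poly q x r t"
  by (induction r arbitrary: s t) (simp_all add: frobenius_add algebra_simps)

lemma span_poly_scale: "span_poly q x r (\<iota> c * t) = \<iota> c * span_poly q x r t"
  by (induction r arbitrary: t) (simp_all add: power_mult_distrib embedding_power_q algebra_simps)

lemma span_poly_diff_scale:
  "span_poly q x r (s - \<iota> c * t) = span_poly q x r s - \<iota> c * span_poly q x r t"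
  using span_poly_add[of x r s "\<iota> (- c) * t"] unfolding span_poly_scale by (simp add: hom_distribs)

text \<open>At the stage that introduces x_i the two terms of the recursion agree; from then on the
  value stays 0.\<close>

lemma span_poly_generator:
  assumes "1 \<le> i" "i \<le> r" shows "span_poly q x r (x i) = 0"
  using assms(2)
proof (induction r rule: dec_induct)
  case base
  obtain k where k: "i = Suc k" using assms by (cases i) auto
  have "span_poly q x k (x i) ^ q = span_poly q x k (x i) ^ (q - 1) * span_poly q x k (x i)"
    using power_minus_mult[of q "span_poly q x k (x i)"] q_gt_1 by simp
  then show ?case by (simp add: k)
next
  case (step n)
  then show ?case using q_gt_1 by (simp add: zero_power)
qed

text \<open>Only the exponents q^j occur, because the q-th power shifts such a polynomial by one
  place and raises its coefficients to the power q. This form lets a value of the bilinear form at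
  transformed vectors be expanded.\<close>

lemma span_poly_coeffs:
  fixes x :: "nat \<Rightarrow> 'b"
  assumes A: "subring_set A" and x: "\<And>i. 1 \<le> i \<Longrightarrow> i \<le> r \<Longrightarrow> x i \<in> A"
  shows "\<exists>p. (\<forall>j. p j \<in> A) \<and> p r = 1 \<and> (\<forall>j>r. p j = 0) \<and>
    (\<forall>t. span_poly q x r t = (\<Sum>j\<le>r. p j * t ^ (q ^ j)))"
  using x
proof (induction r)
  case 0
  then show ?case using subring_set_closed[OF A] by (intro exI[of _ "\<lambda>j. if j = 0 then 1 else 0"]) auto
next
  case (Suc r)
  note cl = subring_set_closed[OF A]
  obtain p where p: "\<And>j. p j \<in> A" "p r = 1" "\<And>j. j > r \<Longrightarrow> p j = 0"
    "\<And>t. span_poly q x r t = (\<Sum>j\<le>r. p j * t ^ (q ^ j))"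
    using Suc.IH Suc.prems by (metis le_SucI)
  define d where "d = span_poly q x r (x (Suc r)) ^ (q - 1)"
  \<comment> \<open>The shifted q-th power minus \<open>d\<close> times the old polynomial. As
    \<open>p\<close> vanishes beyond \<open>r\<close>, the new leading coefficient is again
    1.\<close>
  define p' where "p' j = (case j of 0 \<Rightarrow> 0 | Suc i \<Rightarrow> p i ^ q) - d * p j" for j
  have "d \<in> A" unfolding d_def p(4) using p(1) Suc.prems
    by (intro cl(6-8)) auto
  then have "p' j \<in> A" for j using p(1) cl by (auto simp: p'_def split: nat.split)
  moreover have "p' (Suc r) = 1" using p by (simp add: p'_def)
  moreover have "p' j = 0" if "j > Suc r" for j
    using p that q_gt_1 by (auto simp: p'_def zero_power split: nat.split)
  moreover have "span_poly q x (Suc r) t = (\<Sum>j\<le>Suc r. p' j * t ^ (q ^ j))" for t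
  proof -
    have "span_poly q x r t ^ q = (\<Sum>j\<le>r. (p j * t ^ (q ^ j)) ^ q)"
      unfolding p(4) using frobenius_iter_sum[of "\<lambda>j. p j * t ^ q ^ j" "{..r}" 1] by simp
    also have "\<dots> = (\<Sum>j\<le>r. p j ^ q * t ^ (q ^ Suc j))"
      by (simp add: power_mult_distrib mult.commute flip: power_mult)
    also have "\<dots> = (\<Sum>j\<le>Suc r. (case j of 0 \<Rightarrow> 0 | Suc i \<Rightarrow> p i ^ q) * t ^ (q ^ j))"
      by (simp only: sum.atMost_Suc_shift) simp
    finally have 1: "span_poly q x r t ^ q = \<dots>" .
    have 2: "span_poly q x r t = (\<Sum>j\<le>Suc r. p j * t ^ (q ^ j))"
      unfolding p(4) using p(3) by simp
    have "span_poly q x (Suc r) t = span_poly q x r t ^ q - d * span_poly q x r t"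
      by (simp add: d_def)
    also have "\<dots> = (\<Sum>j\<le>Suc r. p' j * t ^ (q ^ j))"
      unfolding 1 unfolding 2 p'_def
      by (simp only: left_diff_distrib sum_subtractf sum_distrib_left mult.assoc)
    finally show ?thesis .
  qed
  ultimately show ?case by (intro exI[of _ p']) blast
qed

text \<open>Two representations with different multiples of the new generator could be solved for
  it, which would place it in the old span.\<close>

lemma inj_on_span_set_Suc:
  assumes "x (Suc r) \<notin> span_set \<iota> x r"
  shows "inj_on (\<lambda>(u, c). u + \<iota> c * x (Suc r)) (span_set \<iota> x r \<times> UNIV)"
proof (rule inj_onI, clarify)
  fix u c v d
  assume uv: "u \<in> span_set \<iota> x r" "v \<in> span_set \<iota> x r"
    and eq: "u + \<iota> c * x (Suc r) = v + \<iota> d * x (Suc r)"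
  have "c = d"
  proof (rule ccontr)
    assume "c \<noteq> d"
    have "\<iota> (c - d) * x (Suc r) = v - u" using eq by (simp add: hom_distribs algebra_simps)
    then have "\<iota> (inverse (c - d)) * (v - u) = \<iota> (inverse (c - d) * (c - d)) * x (Suc r)"
      by (simp only: hom_mult mult.assoc)
    also have "\<dots> = x (Suc r)" using \<open>c \<noteq> d\<close> by simp
    finally have "x (Suc r) = \<iota> (inverse (c - d)) * (v + (- u))" by simp
    also have "\<dots> \<in> span_set \<iota> x r" using uv by (intro span_set_scale span_set_add span_set_uminus)
    finally show False using assms by simp
  qed
  then show "u = v \<and> c = d" using eq by simp
qed

lemma card_span_set:
  assumes "\<And>i. i < r \<Longrightarrow> x (Suc i) \<notin> span_set \<iota> x i"
  shows "card (span_set \<iota> x r) = q ^ r"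
  using assms
proof (induction r)
  case (Suc r)
  then show ?case
    by (simp add: card_image[OF inj_on_span_set_Suc] card_cartesian_product mult.commute flip: q_eq)
qed simp

text \<open>The span of r + 1 generators is split into cosets of the span of the first
  \<open>r\<close>. By induction a coset contributes the previous polynomial at t - c x_{r+1}, and
  the product over c is \<open>prod_diff_embedding\<close>.\<close>

lemma span_poly_eq_prod_diff:
  assumes "\<And>i. i < r \<Longrightarrow> x (Suc i) \<notin> span_set \<iota> x i"
  shows "span_poly q x r t = (\<Prod>u\<in>span_set \<iota> x r. t - u)"
  using assms
proof (induction r arbitrary: t)
  case (Suc r)
  have "(\<Prod>u\<in>span_set \<iota> x (Suc r). t - u) =
      (\<Prod>(u, c)\<in>span_set \<iota> x r \<times> UNIV. t - (u + \<iota> c * x (Suc r)))"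
    unfolding span_set.simps
    by (subst prod.reindex[OF inj_on_span_set_Suc]) (simp_all add: Suc.prems case_prod_unfold)
  also have "\<dots> = (\<Prod>u\<in>span_set \<iota> x r. \<Prod>c\<in>UNIV. t - (u + \<iota> c * x (Suc r)))"
    by (rule prod.cartesian_product[symmetric])
  also have "\<dots> = (\<Prod>c\<in>UNIV. \<Prod>u\<in>span_set \<iota> x r. (t - \<iota> c * x (Suc r)) - u)"
    by (subst prod.swap) (simp add: algebra_simps)
  also have "\<dots> = (\<Prod>c\<in>UNIV. span_poly q x r (t - \<iota> c * x (Suc r)))"
    using Suc by simp
  also have "\<dots> = span_poly q x (Suc r) t"
    by (simp add: span_poly_diff_scale prod_diff_embedding)
  finally show ?case ..
qed simp

lemma span_poly_eq_prod_add:
  assumes "\<And>i. i < r \<Longrightarrow> x (Suc i) \<notin> span_set \<iota> x i"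
  shows "span_poly q x r t = (\<Prod>u\<in>span_set \<iota> x r. t + u)"
proof -
  have "(\<Prod>u\<in>span_set \<iota> x r. t - u) = (\<Prod>u\<in>span_set \<iota> x r. t + u)"
    by (rule prod.reindex_bij_witness[of _ uminus uminus]) (auto intro: span_set_uminus)
  then show ?thesis using span_poly_eq_prod_diff[of r x t] assms by simp
qed

lemma span_poly_nonzero:
  assumes "\<And>i. i \<le> r \<Longrightarrow> x (Suc i) \<notin> span_set \<iota> x i"
  shows "span_poly q x r (x (Suc r)) \<noteq> 0"
  using assms[of r] by (subst span_poly_eq_prod_diff) (auto simp: assms finite_span_set)

text \<open>The polynomial is \<phi>(T) - \<phi>(\<theta>). Its degree will match the number of
  conjugates of \<theta>.\<close>

lemma span_poly_monic_root:
  fixes x :: "nat \<Rightarrow> 'b"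
  assumes A: "subring_set A" and x: "\<And>i. 1 \<le> i \<Longrightarrow> i \<le> r \<Longrightarrow> x i \<in> A"
    and \<theta>: "span_poly q x r \<theta> \<in> A"
  shows "\<exists>P. degree P = q ^ r \<and> lead_coeff P = 1 \<and> (\<forall>i. coeff P i \<in> A) \<and> poly P \<theta> = 0"
proof -
  note cl = subring_set_closed[OF A]
  obtain p where p: "\<And>j. p j \<in> A" "p r = 1" 
    "\<And>t. span_poly q x r t = (\<Sum>j\<le>r. p j * t ^ (q ^ j))"
    using span_poly_coeffs[OF A, of r x] x by auto
  define P where "P = (\<Sum>j\<le>r. monom (p j) (q ^ j)) - [:span_poly q x r \<theta>:]"
  have mon: "q ^ j \<le> q ^ r" if "j \<le> r" for j using q_gt_1 that by (simp add: power_increasing)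
  have inj: "q ^ j = q ^ r \<longleftrightarrow> j = r" for j using q_gt_1 by (simp add: power_inject_exp)
  have "coeff P (q ^ r) = (\<Sum>j\<le>r. if j = r then p j else 0)"
    using q_gt_1 by (simp add: P_def coeff_sum inj coeff_pCons split: nat.split)
  then have 1: "coeff P (q ^ r) = 1" using p by simp
  have "degree P \<le> q ^ r" unfolding P_def
    by (intro degree_diff_le degree_sum_le) (auto intro: order.trans[OF degree_monom_le] mon)
  moreover have "degree P \<ge> q ^ r" using 1 by (intro le_degree) simp
  ultimately have "degree P = q ^ r" by simp
  moreover have "coeff P i \<in> A" for i using p(1) \<theta>
    by (auto simp: P_def coeff_sum coeff_pCons split: nat.split intro!: cl)
  moreover have "poly P \<theta> = 0" by (simp add: P_def poly_sum poly_monom p(3))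
  ultimately show ?thesis using 1 by auto
qed

end


section \<open>Substitution homomorphisms\<close>

lemma Const_hom: "comm_ring_hom (Const :: 'a::field \<Rightarrow> 'a mpoly)"
  by unfold_locales (simp_all add: Const_def single_add mult_single)

interpretation Const: comm_ring_hom "Const :: 'a::field \<Rightarrow> 'a mpoly" by (rule Const_hom)

lemma poly_mapping_eq_sum_single:
  "f = (\<Sum>\<mu>\<in>Poly_Mapping.keys f. Poly_Mapping.single \<mu> (Poly_Mapping.lookup f \<mu>))"
  by (rule poly_mapping_eqI)
    (auto simp: lookup_sum lookup_single when_def in_keys_iff intro: sum.neutral)

definition subst_monom :: "(nat \<Rightarrow> 'a::field mpoly) \<Rightarrow> (nat \<Rightarrow>\<^sub>0 nat) \<Rightarrow> 'a mpoly" where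
  "subst_monom s \<mu> = (\<Prod>i\<in>Poly_Mapping.keys \<mu>. s i ^ Poly_Mapping.lookup \<mu> i)"

lemma subst_monom_superset:
  assumes "finite I" "Poly_Mapping.keys \<mu> \<subseteq> I"
  shows "subst_monom s \<mu> = (\<Prod>i\<in>I. s i ^ Poly_Mapping.lookup \<mu> i)"
  unfolding subst_monom_def using assms
  by (intro prod.mono_neutral_left) (auto simp: in_keys_iff)

lemma subst_monom_add: "subst_monom s (\<mu> + \<nu>) = subst_monom s \<mu> * subst_monom s \<nu>"
proof -
  let ?I = "Poly_Mapping.keys \<mu> \<union> Poly_Mapping.keys \<nu>"
  have "subst_monom s (\<mu> + \<nu>) = (\<Prod>i\<in>?I. s i ^ Poly_Mapping.lookup (\<mu> + \<nu>) i)"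
    by (rule subst_monom_superset) (use keys_add[of \<mu> \<nu>] in auto)
  also have "\<dots> = subst_monom s \<mu> * subst_monom s \<nu>"
    by (simp add: subst_monom_superset[of ?I] lookup_add power_add prod.distrib)
  finally show ?thesis .
qed

text \<open>Polynomials with different supports are compared termwise over a common index set, where
  the extra coefficients are 0.\<close>

lemma subst_superset:
  assumes "finite I" "Poly_Mapping.keys f \<subseteq> I"
  shows "subst s f = (\<Sum>\<mu>\<in>I. Const (Poly_Mapping.lookup f \<mu>) * subst_monom s \<mu>)"
  unfolding subst_def subst_monom_def using assms
  by (intro sum.mono_neutral_left) (auto simp: in_keys_iff)

lemma subst_add: "subst s (f + g) = subst s f + subst s g"
proof -
  let ?I = "Poly_Mapping.keys f \<union> Poly_Mapping.keys g"
  have "subst s (f + g) = (\<Sum>\<mu>\<in>?I. Const (Poly_Mapping.lookup (f + g) \<mu>) * subst_monom s \<mu>)"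
    by (rule subst_superset) (use keys_add[of f g] in auto)
  also have "\<dots> = subst s f + subst s g"
    by (simp add: subst_superset[of ?I] lookup_add hom_distribs sum.distrib algebra_simps)
  finally show ?thesis .
qed

lemma subst_0 [simp]: "subst s 0 = 0"
  by (simp add: subst_def)

lemma subst_sum: "subst s (sum f I) = (\<Sum>i\<in>I. subst s (f i))"
  by (induction I rule: infinite_finite_induct) (simp_all add: subst_add)

lemma subst_single: "subst s (Poly_Mapping.single \<mu> c) = Const c * subst_monom s \<mu>"
  by (subst subst_superset[of "{\<mu>}"]) auto

text \<open>Both sides are additive in each factor, which reduces the claim to single terms.\<close>

lemma subst_mult: "subst s (f * g) = subst s f * subst s g"
proof -
  have 1: "subst s (Poly_Mapping.single \<mu> c * g) = subst s (Poly_Mapping.single \<mu> c) * subst s g" for \<mu> c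
  proof -
    have "subst s (Poly_Mapping.single \<mu> c * Poly_Mapping.single \<nu> d) =
        subst s (Poly_Mapping.single \<mu> c) * subst s (Poly_Mapping.single \<nu> d)" for \<nu> d
      by (simp add: mult_single subst_single subst_monom_add hom_distribs algebra_simps)
    then show ?thesis
      by (subst (1 2) poly_mapping_eq_sum_single[of g]) (simp only: sum_distrib_left subst_sum)
  qed
  show ?thesis
    by (subst (1 2) poly_mapping_eq_sum_single[of f]) (simp only: sum_distrib_right subst_sum 1)
qed

lemma subst_Const [simp]: "subst s (Const c) = Const c"
  unfolding Const_def subst_single by (simp add: subst_monom_def flip: Const_def)

lemma subst_Var [simp]: "subst s (Var i) = s i"
  unfolding Var_def subst_single by (simp add: subst_monom_def Const.hom_one)

lemma subst_hom: "comm_ring_hom (subst s)"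
  by unfold_locales (use subst_Const[of s 1] subst_Const[of s 0] in
      \<open>simp_all add: subst_add subst_mult Const.hom_one\<close>)

lemma subst_Var_id: "subst Var f = f"
proof -
  have mon: "subst_monom Var \<mu> = Poly_Mapping.single \<mu> (1::'a::field)" for \<mu>
  proof -
    have pow: "(Var i :: 'a mpoly) ^ k = Poly_Mapping.single (Poly_Mapping.single i k) 1" for i k
      by (induction k) (simp_all add: Var_def mult_single flip: single_add)
    have "(\<Prod>i\<in>I. Poly_Mapping.single (g i) (1::'a)) = Poly_Mapping.single (sum g I) 1"
      for I :: "nat set" and g :: "nat \<Rightarrow> nat \<Rightarrow>\<^sub>0 nat"
      by (induction I rule: infinite_finite_induct) (simp_all add: mult_single)
    then show ?thesis unfolding subst_monom_def pow by (simp flip: poly_mapping_eq_sum_single)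
  qed
  have "subst Var f = (\<Sum>\<mu>\<in>Poly_Mapping.keys f. Poly_Mapping.single \<mu> (Poly_Mapping.lookup f \<mu>))"
    by (subst subst_superset[OF _ order.refl]) (simp_all add: mon Const_def mult_single)
  then show ?thesis by (simp flip: poly_mapping_eq_sum_single)
qed

lemma subst_subst: "subst s (subst t f) = subst (\<lambda>i. subst s (t i)) f"
proof -
  interpret comm_ring_hom "subst s" by (rule subst_hom)
  show ?thesis unfolding subst_def[of t] subst_def[of "\<lambda>i. subst s (t i)"]
    by (simp add: hom_distribs)
qed

section \<open>The coordinate ring\<close>

text \<open>With \<open>s = Var\<close> and \<open>subst_Var_id\<close> this acts as an induction
  principle: a property defining a subring that contains the constants and x_1, ..., x_n holds on
  the whole coordinate ring.\<close>

lemma subst_in_subring_set: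
  assumes A: "subring_set A" and C: "\<And>c. Const c \<in> A"
    and s: "\<And>i. i \<in> {1..n} \<Longrightarrow> s i \<in> A" and f: "f \<in> coord_ring n"
  shows "subst s f \<in> A"
  unfolding subst_def
proof (intro subring_set_closed[OF A] C s)
  fix \<mu> i assume "\<mu> \<in> Poly_Mapping.keys f" "i \<in> Poly_Mapping.keys \<mu>"
  then show "i \<in> {1..n}" using f unfolding coord_ring_def by blast
qed

lemma subring_set_coord_ring: "subring_set (coord_ring n :: 'a::field mpoly set)"
  unfolding subring_set_def
proof (intro conjI ballI)
  show "1 \<in> (coord_ring n :: 'a mpoly set)"
    by (auto simp: coord_ring_def)
  fix f g :: "'a mpoly" assume fg: "f \<in> coord_ring n" "g \<in> coord_ring n"
  have "Poly_Mapping.keys (f - g) \<subseteq> Poly_Mapping.keys f \<union> Poly_Mapping.keys g"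
    by (auto simp: in_keys_iff lookup_minus)
  then show "f - g \<in> coord_ring n" using fg by (fastforce simp: coord_ring_def)
  show "f * g \<in> coord_ring n" unfolding coord_ring_def
  proof (intro CollectI ballI)
    fix \<mu> assume "\<mu> \<in> Poly_Mapping.keys (f * g)"
    then obtain \<nu> \<rho> where "\<mu> = \<nu> + \<rho>" "\<nu> \<in> Poly_Mapping.keys f" "\<rho> \<in> Poly_Mapping.keys g"
      using keys_mult by blast
    then show "Poly_Mapping.keys \<mu> \<subseteq> {1..n}"
      using fg keys_add[of \<nu> \<rho>] unfolding coord_ring_def by blast
  qed
qed

lemma Const_in_coord_ring: "Const c \<in> coord_ring n"
  by (auto simp: coord_ring_def Const_def)

lemma Var_in_coord_ring: "i \<in> {1..n} \<Longrightarrow> Var i \<in> coord_ring n"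
  by (auto simp: coord_ring_def Var_def)

section \<open>Linear substitutions\<close>

text \<open>Like \<open>act_var\<close>, but with the rows of the matrix itself instead of those of
  its inverse, which keeps matrix inversion out of the computations.\<close>

definition lin_var :: "'a::field mat \<Rightarrow> nat \<Rightarrow> 'a mpoly" where
  "lin_var M i = (if i \<in> {1..dim_row M}
     then \<Sum>j = 1..dim_row M. Const (M $$ (i - 1, j - 1)) * Var j else Var i)"

text \<open>The order of the factors is reversed: the inner substitution produces linear forms by
  rows of \<open>N\<close>, whose variables are then replaced by rows of \<open>M\<close>.\<close>

lemma subst_lin_var_mult:
  assumes M: "M \<in> carrier_mat n n" and N: "N \<in> carrier_mat n n"
  shows "subst (lin_var M) (subst (lin_var N) f) = subst (lin_var (N * M)) f"
proof -
  interpret comm_ring_hom "subst (lin_var M)" by (rule subst_hom)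
  have "subst (lin_var M) (lin_var N i) = lin_var (N * M) i" for i
  proof (cases "i \<in> {1..n}")
    case True
    have "subst (lin_var M) (lin_var N i) =
        (\<Sum>j = 1..n. Const (N $$ (i - 1, j - 1)) * (\<Sum>k = 1..n. Const (M $$ (j - 1, k - 1)) * Var k))"
      using True M N by (auto simp: lin_var_def hom_distribs)
    also have "\<dots> = (\<Sum>k = 1..n. (\<Sum>j = 1..n. Const (N $$ (i - 1, j - 1) * M $$ (j - 1, k - 1))) * Var k)"
      by (simp only: sum_distrib_left sum_distrib_right hom_distribs mult.assoc) (rule sum.swap)
    also have "\<dots> = (\<Sum>k = 1..n. Const ((N * M) $$ (i - 1, k - 1)) * Var k)"
    proof (rule sum.cong[OF refl])
      fix k assume k: "k \<in> {1..n}"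
      have "(\<Sum>j = 1..n. Const (N $$ (i - 1, j - 1) * M $$ (j - 1, k - 1))) =
          Const (\<Sum>j = 0..<n. N $$ (i - 1, j) * M $$ (j, k - 1))"
        unfolding Const.hom_sum
        by (rule sum.reindex_bij_witness[of _ Suc "\<lambda>j. j - 1"]) auto
      also have "(\<Sum>j = 0..<n. N $$ (i - 1, j) * M $$ (j, k - 1)) = (N * M) $$ (i - 1, k - 1)"
      proof -
        have "i - 1 < n" "k - 1 < n" using True k by auto
        then show ?thesis using M N by (simp add: scalar_prod_def)
      qed
      finally show "(\<Sum>j = 1..n. Const (N $$ (i - 1, j - 1) * M $$ (j - 1, k - 1))) * Var k =
          Const ((N * M) $$ (i - 1, k - 1)) * Var k" by simp
    qed
    also have "\<dots> = lin_var (N * M) i" using True M N by (auto simp: lin_var_def)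
    finally show ?thesis .
  next
    case False
    then show ?thesis using M N by (auto simp: lin_var_def)
  qed
  then show ?thesis by (simp add: subst_subst)
qed

lemma subst_lin_var_one: "subst (lin_var (1\<^sub>m n)) f = f"
proof -
  have "lin_var (1\<^sub>m n) i = (Var i :: 'a::field mpoly)" for i
  proof (cases "i \<in> {1..n}")
    case True
    have "Const ((1\<^sub>m n :: 'a mat) $$ (i - 1, j - 1)) * Var j = (if j = i then Var i else 0)"
      if "j \<in> {1..n}" for j
    proof -
      have "i - 1 < n" "j - 1 < n" "i - 1 = j - 1 \<longleftrightarrow> j = i" using True that by auto
      then show ?thesis by (simp add: Const.hom_one)
    qed
    then have "lin_var (1\<^sub>m n) i = (\<Sum>j = 1..n. if j = i then Var i else (0 :: 'a mpoly))"
      using True by (simp add: lin_var_def)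
    then show ?thesis using True by simp
  qed (auto simp: lin_var_def)
  then have "lin_var (1\<^sub>m n) = (Var :: nat \<Rightarrow> 'a mpoly)" by auto
  then show ?thesis by (simp add: subst_Var_id)
qed

lemma subst_lin_var_coord_ring:
  assumes "M \<in> carrier_mat n n" "f \<in> coord_ring n"
  shows "subst (lin_var M) f \<in> coord_ring n"
proof (rule subst_in_subring_set[OF subring_set_coord_ring Const_in_coord_ring _ assms(2)])
  fix i assume "i \<in> {1..n}"
  then show "lin_var M i \<in> coord_ring n" using assms(1) unfolding lin_var_def
    by (auto intro!: subring_set_closed(6,8)[OF subring_set_coord_ring] Const_in_coord_ring Var_in_coord_ring)
qed

section \<open>The group action on polynomials and on fractions\<close>

lemma act_eq_subst_lin_var:
  assumes "g \<in> carrier_mat n n" "mat_inverse g = Some M"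
  shows "act g = subst (lin_var M)"
proof -
  have "M \<in> carrier_mat n n" using mat_inverse(2)[OF assms] by auto
  then have "act_var g i = lin_var M i" for i using assms by (auto simp: act_var_def lin_var_def)
  then show ?thesis unfolding act_def by (metis ext)
qed

text \<open>Equality of fractions is a cross product identity, which the homomorphism preserves;
  injectivity keeps the denominators nonzero. Thus the definite description has a unique
  value.\<close>

lemma act_fract_Fract:
  assumes "comm_ring_hom (act g)" and inj: "\<And>f. act g f = 0 \<Longrightarrow> f = 0" and "f2 \<noteq> 0"
  shows "act_fract g (Fract f1 f2) = Fract (act g f1) (act g f2)"
  unfolding act_fract_def
proof (rule the_equality)
  interpret comm_ring_hom "act g" by fact
  show "\<exists>k1 k2. k2 \<noteq> 0 \<and> Fract f1 f2 = Fract k1 k2 \<and>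
      Fract (act g f1) (act g f2) = Fract (act g k1) (act g k2)"
    using assms(3) by blast
  fix H assume "\<exists>k1 k2. k2 \<noteq> 0 \<and> Fract f1 f2 = Fract k1 k2 \<and> H = Fract (act g k1) (act g k2)"
  then obtain k1 k2 where k: "k2 \<noteq> 0" "Fract f1 f2 = Fract k1 k2" "H = Fract (act g k1) (act g k2)" by blast
  then have "f1 * k2 = k1 * f2" using assms(3) by (simp add: eq_fract)
  then have "act g f1 * act g k2 = act g k1 * act g f2" by (metis hom_mult)
  then show "H = Fract (act g f1) (act g f2)" using k assms(3) inj by (metis eq_fract(1))
qed

lemma act_fract_hom:
  assumes "comm_ring_hom (act g)" and inj: "\<And>f. act g f = 0 \<Longrightarrow> f = 0"
  shows "field_hom (act_fract g)"
    and "act_fract g (to_fract f) = to_fract (act g f)"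
proof -
  interpret comm_ring_hom "act g" by fact
  note F = act_fract_Fract[OF assms]
  have nz: "act g f \<noteq> 0" if "f \<noteq> 0" for f using inj that by blast
  show tf: "act_fract g (to_fract f) = to_fract (act g f)" for f
    unfolding to_fract_def by (subst F) auto
  show "field_hom (act_fract g)"
  proof
    show "act_fract g 1 = 1" "act_fract g 0 = 0"
      using tf[of 1] tf[of 0] by simp_all
    fix x y
    show "act_fract g (x + y) = act_fract g x + act_fract g y"
      by (cases x; cases y) (simp add: F nz hom_distribs)
    show "act_fract g (x * y) = act_fract g x * act_fract g y"
      by (cases x; cases y) (simp add: F nz hom_distribs)
  qed
qed


section \<open>The bilinear form\<close>

text \<open>The polar form of h_1, with Gram matrix \<open>Y_form\<close> and coordinates numbered
  from 1. The antidiagonal sum already contains the off-diagonal entries of \<open>X2\<close>. The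
  vectors live in an arbitrary ring, so that coordinate functions and their powers can be
  inserted.\<close>

definition bil_form :: "nat \<Rightarrow> 'b::comm_ring_1 \<Rightarrow> (nat \<Rightarrow> 'b) \<Rightarrow> (nat \<Rightarrow> 'b) \<Rightarrow> 'b" where
  "bil_form m \<alpha> u v = (\<Sum>i = 1..2 * m + 2. u i * v (2 * m + 3 - i))
     + 2 * u (m + 1) * v (m + 1) + 2 * \<alpha> * u (m + 2) * v (m + 2)"

lemma sum_antidiagonal_halves:
  fixes u v :: "nat \<Rightarrow> 'b::comm_semiring_1"
  shows "(\<Sum>i = 1..2 * m + 2. u i * v (2 * m + 3 - i)) =
    (\<Sum>i = 1..m + 1. u i * v (2 * m + 3 - i) + u (2 * m + 3 - i) * v i)"
proof -
  let ?f = "\<lambda>i. u i * v (2 * m + 3 - i)"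
  have "sum ?f {1..2 * m + 2} = sum ?f {1..m + 1} + sum ?f {m + 2..2 * m + 2}"
  proof -
    have e: "m + 1 + (m + 1) = 2 * m + 2" "m + 1 + 1 = m + 2" "1 \<le> m + 1 + 1" by simp_all
    show ?thesis using sum.ub_add_nat[of 1 "m + 1" ?f "m + 1"] unfolding e(1,2) by simp
  qed
  also have "sum ?f {m + 2..2 * m + 2} = (\<Sum>i = 1..m + 1. u (2 * m + 3 - i) * v i)"
    by (rule sum.reindex_bij_witness[of _ "\<lambda>i. 2 * m + 3 - i" "\<lambda>i. 2 * m + 3 - i"]) auto
  finally show ?thesis by (simp only: sum.distrib)
qed

lemma h_eq_bil_form:
  assumes "k \<ge> 2"
  shows "h q m a k = bil_form m (Const a) Var (\<lambda>i. Var i ^ (q ^ (k - 1)))"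
proof -
  have "(\<Sum>i = 1..m + 1. Var i * Var (2 * m + 3 - i) ^ (q ^ (k - 1)) + Var (2 * m + 3 - i) * Var i ^ (q ^ (k - 1)))
    = (\<Sum>i = 1..m + 1. Var (2 * m + 3 - i) ^ (q ^ (k - 1)) * Var i
         + Var (2 * m + 3 - i) * Var i ^ (q ^ (k - 1)) :: 'a mpoly)"
    by (simp only: mult.commute)
  then have "(\<Sum>i = 1..2 * m + 2. Var i * Var (2 * m + 3 - i) ^ (q ^ (k - 1)))
    = (\<Sum>i = 1..m + 1. Var (2 * m + 3 - i) ^ (q ^ (k - 1)) * Var i
         + Var (2 * m + 3 - i) * Var i ^ (q ^ (k - 1)) :: 'a mpoly)"
    using sum_antidiagonal_halves[of Var "\<lambda>i. Var i ^ (q ^ (k - 1)) :: 'a mpoly" m] by simp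
  then show ?thesis using assms
    unfolding h_def bil_form_def by (simp add: distrib_left mult.assoc)
qed

text \<open>h_1 is the quadratic form itself, so the polar form at (x, x) yields it only up to the
  factor 2; recovering h_1 uses that q is odd.\<close>

lemma two_h_1_eq_bil_form: "2 * h q m a 1 = bil_form m (Const a) Var Var"
proof -
  have "(\<Sum>i = 1..m + 1. Var i * Var (2 * m + 3 - i) + Var (2 * m + 3 - i) * Var i :: 'a mpoly)
    = 2 * (\<Sum>i = 1..m. Var (2 * m + 3 - i) * Var i) + 2 * (Var (m + 1) * Var (m + 2))"
  proof -
    have "(\<Sum>i = 1..m + 1. Var i * Var (2 * m + 3 - i) + Var (2 * m + 3 - i) * Var i :: 'a mpoly)
      = (\<Sum>i = 1..m. 2 * (Var (2 * m + 3 - i) * Var i)) + 2 * (Var (m + 1) * Var (m + 2))"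
    proof -
      have e: "2 * m + 3 - (m + 1) = m + 2" by simp
      have c: "x * y + y * x = 2 * (y * x)" for x y :: "'a mpoly"
        by (simp only: mult_2 mult.commute[of x y])
      show ?thesis unfolding c using e by (simp add: mult.commute[of "Var (Suc (Suc m))"])
    qed
    then show ?thesis by (simp only: sum_distrib_left)
  qed
  then have "(\<Sum>i = 1..2 * m + 2. Var i * Var (2 * m + 3 - i) :: 'a mpoly)
    = 2 * (\<Sum>i = 1..m. Var (2 * m + 3 - i) * Var i) + 2 * (Var (m + 1) * Var (m + 2))"
    using sum_antidiagonal_halves[of Var "Var :: nat \<Rightarrow> 'a mpoly" m] by simp
  then show ?thesis
    unfolding h_def bil_form_def by (simp add: distrib_left power2_eq_square mult.assoc)
qed

lemma bil_form_commute: "bil_form m \<alpha> u v = bil_form m \<alpha> v u"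
proof -
  have "(\<Sum>i = 1..2 * m + 2. u i * v (2 * m + 3 - i)) = (\<Sum>i = 1..2 * m + 2. v i * u (2 * m + 3 - i))"
    by (rule sum.reindex_bij_witness[of _ "\<lambda>i. 2 * m + 3 - i" "\<lambda>i. 2 * m + 3 - i"])
      (auto simp: mult.commute)
  then show ?thesis by (simp add: bil_form_def mult_ac)
qed

lemma bil_form_sum_left:
  "bil_form m \<alpha> (\<lambda>i. \<Sum>j\<in>I. c j * u j i) v = (\<Sum>j\<in>I. c j * bil_form m \<alpha> (u j) v)"
proof -
  have "(\<Sum>i = 1..2 * m + 2. (\<Sum>j\<in>I. c j * u j i) * v (2 * m + 3 - i)) =
      (\<Sum>j\<in>I. c j * (\<Sum>i = 1..2 * m + 2. u j i * v (2 * m + 3 - i)))"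
    by (simp only: sum_distrib_left sum_distrib_right mult.assoc) (rule sum.swap)
  then show ?thesis
    by (simp add: bil_form_def distrib_left sum.distrib sum_distrib_left sum_distrib_right mult_ac)
qed

lemma bil_form_sum_right:
  "bil_form m \<alpha> v (\<lambda>i. \<Sum>j\<in>I. c j * u j i) = (\<Sum>j\<in>I. c j * bil_form m \<alpha> v (u j))"
  by (subst (1 2) bil_form_commute) (rule bil_form_sum_left)

section \<open>The Gram matrix and invariance of the form\<close>

lemma Y_form_carrier: "Y_form m a \<in> carrier_mat (2 * m + 2) (2 * m + 2)"
proof -
  have 1: "antidiag m @\<^sub>r 0\<^sub>m 2 m \<in> carrier_mat (m + 2) m"
    by (intro carrier_append_rows) (auto simp: antidiag_def)
  have "Y_form m a \<in> carrier_mat ((m + 2) + m) ((m + 2) + m)" unfolding Y_form_def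
    by (intro four_block_carrier_mat) (auto simp: X2_def mat_of_rows_list_def)
  then show ?thesis by (simp add: mult_2)
qed

lemma Y_form_index:
  assumes "i < 2 * m + 2" "j < 2 * m + 2"
  shows "Y_form m a $$ (i, j) = (if i + j = 2 * m + 1 then 1 else 0)
    + (if i = m \<and> j = m then 2 else 0) + (if i = m + 1 \<and> j = m + 1 then 2 * a else 0)"
proof -
  have X2: "X2 a $$ (0, 0) = 2" "X2 a $$ (0, 1) = 1" "X2 a $$ (1, 0) = 1" "X2 a $$ (1, 1) = 2 * a"
    and d: "dim_row (X2 a) = 2" "dim_col (X2 a) = 2" "dim_row (antidiag m :: 'a mat) = m" "dim_col (antidiag m :: 'a mat) = m"
    by (simp_all add: X2_def mat_of_rows_list_def antidiag_def)
  have AD: "antidiag m $$ (k, l) = (if k + l + 1 = m then 1 else 0 :: 'a)" if "k < m" "l < m" for k l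
    using that by (simp add: antidiag_def)
  have AR: "(antidiag m @\<^sub>r 0\<^sub>m 2 m) $$ (k, l) = (if k + l + 1 = m then 1 else 0 :: 'a)"
    if "k < m + 2" "l < m" for k l
    unfolding append_rows_def using that
    by (subst index_mat_four_block(1)) (auto simp: d AD)
  have UL: "four_block_mat (0\<^sub>m m m) (0\<^sub>m m 2) (0\<^sub>m 2 m) (X2 a) $$ (k, l) =
      (if k < m \<or> l < m then 0 else X2 a $$ (k - m, l - m))" if "k < m + 2" "l < m + 2" for k l
    using that by (subst index_mat_four_block(1)) (auto simp: d)
  have LL: "four_block_mat (antidiag m) (0\<^sub>m m 2) (0\<^sub>m 0 m) (0\<^sub>m 0 2) $$ (k, l) =
      (if k + l + 1 = m then 1 else 0 :: 'a)" if "k < m" "l < m + 2" for k l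
    using that by (subst index_mat_four_block(1)) (auto simp: d AD)
  have Y: "Y_form m a $$ (i, j) =
     (if i < m + 2 then if j < m + 2 then (if i < m \<or> j < m then 0 else X2 a $$ (i - m, j - m))
        else (if i + (j - (m + 2)) + 1 = m then 1 else 0)
      else if j < m + 2 then (if (i - (m + 2)) + j + 1 = m then 1 else 0) else 0)"
    unfolding Y_form_def using assms
    by (subst index_mat_four_block(1)) (auto simp: d UL LL AR AD)
  consider "i < m" | "i = m" | "i = m + 1" | "m + 2 \<le> i" by linarith
  then show ?thesis
  proof cases
    case 1
    then show ?thesis unfolding Y using assms by auto
  next
    case 2
    then show ?thesis unfolding Y using assms X2 by (cases "j = m"; cases "j = m + 1") auto
  next
    case 3
    then show ?thesis unfolding Y using assms X2 by (cases "j = m"; cases "j = m + 1") auto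
  next
    case 4
    then show ?thesis unfolding Y using assms by auto
  qed
qed

lemma Y_form_sym: "i < 2 * m + 2 \<Longrightarrow> j < 2 * m + 2 \<Longrightarrow> Y_form m a $$ (i, j) = Y_form m a $$ (j, i)"
  by (simp add: Y_form_index add.commute)

lemma bil_form_eq_Y_form:
  assumes "comm_ring_hom \<iota>" and n: "n = 2 * m + 2"
  shows "bil_form m (\<iota> a) u v =
    (\<Sum>i<n. \<Sum>j<n. \<iota> (Y_form m a $$ (i, j)) * u (i + 1) * v (j + 1))"
proof -
  interpret comm_ring_hom \<iota> by fact
  have "(\<Sum>j<n. \<iota> (Y_form m a $$ (i, j)) * u (i + 1) * v (j + 1)) =
      u (i + 1) * v (n - i) + (if i = m then 2 * u (m + 1) * v (m + 1) else 0)
        + (if i = m + 1 then 2 * \<iota> a * u (m + 2) * v (m + 2) else 0)" if i: "i < n" for i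
  proof -
    have "\<iota> (Y_form m a $$ (i, j)) * u (i + 1) * v (j + 1) =
       (if j = n - 1 - i then u (i + 1) * v (j + 1) else 0) +
       (if j = m then (if i = m then 2 * u (m + 1) * v (m + 1) else 0) else 0) +
       (if j = m + 1 then (if i = m + 1 then 2 * \<iota> a * u (m + 2) * v (m + 2) else 0) else 0)"
      if "j < n" for j
    proof -
      have eq: "i + j = 2 * m + 1 \<longleftrightarrow> j = n - 1 - i" using i n by auto
      have Y: "\<iota> (Y_form m a $$ (i, j)) = (if j = n - 1 - i then 1 else 0)
          + (if i = m \<and> j = m then 2 else 0) + (if i = m + 1 \<and> j = m + 1 then 2 * \<iota> a else 0)"
        using Y_form_index[of i m j a] i that unfolding n eq[symmetric, unfolded n]
        by (simp only: hom_add if_distrib[of \<iota>] hom_one hom_zero hom_mult hom_numeral)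
      show ?thesis unfolding Y by (simp add: distrib_right)
    qed
    then have "(\<Sum>j<n. \<iota> (Y_form m a $$ (i, j)) * u (i + 1) * v (j + 1)) =
       (\<Sum>j<n. (if j = n - 1 - i then u (i + 1) * v (j + 1) else 0)) +
       (\<Sum>j<n. (if j = m then (if i = m then 2 * u (m + 1) * v (m + 1) else 0) else 0)) +
       (\<Sum>j<n. (if j = m + 1 then (if i = m + 1 then 2 * \<iota> a * u (m + 2) * v (m + 2) else 0) else 0))"
      by (simp only: sum.distrib[symmetric]) (rule sum.cong, simp_all only: lessThan_iff)
    moreover have "n - 1 - i + 1 = n - i" using i by auto
    moreover have "n - 1 - i < n" "m < n" "m + 1 < n" using i n by auto
    ultimately show ?thesis by (simp add: sum.delta)
  qed
  note row = this
  have "(\<Sum>i<n. \<Sum>j<n. \<iota> (Y_form m a $$ (i, j)) * u (i + 1) * v (j + 1)) =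
    (\<Sum>i<n. u (i + 1) * v (n - i)) + 2 * u (m + 1) * v (m + 1) + 2 * \<iota> a * u (m + 2) * v (m + 2)"
  proof -
    have "m < n" "m + 1 < n" using n by auto
    moreover have "(\<Sum>i<n. \<Sum>j<n. \<iota> (Y_form m a $$ (i, j)) * u (i + 1) * v (j + 1)) =
      (\<Sum>i<n. u (i + 1) * v (n - i) + (if i = m then 2 * u (m + 1) * v (m + 1) else 0)
        + (if i = m + 1 then 2 * \<iota> a * u (m + 2) * v (m + 2) else 0))"
      by (rule sum.cong) (simp_all only: lessThan_iff row)
    ultimately show ?thesis by (simp add: sum.distrib)
  qed
  also have "(\<Sum>i<n. u (i + 1) * v (n - i)) = (\<Sum>i = 1..n. u i * v (n + 1 - i))"
    by (rule sum.reindex_bij_witness[of _ "\<lambda>i. i - 1" Suc]) auto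
  also have "n + 1 = 2 * m + 3" by (simp add: n)
  finally show ?thesis by (simp only: bil_form_def n)
qed

lemma congruence_index:
  fixes A :: "'a::comm_ring_1 mat"
  assumes M: "M \<in> carrier_mat n n" and A: "A \<in> carrier_mat n n" and k: "k < n" "l < n"
  shows "(M\<^sup>T * A * M) $$ (k, l) = (\<Sum>i<n. \<Sum>j<n. M $$ (i, k) * A $$ (i, j) * M $$ (j, l))"
proof -
  have "(M\<^sup>T * A * M) $$ (k, l) = (\<Sum>j<n. (\<Sum>i<n. M $$ (i, k) * A $$ (i, j)) * M $$ (j, l))"
    using k M A mult_carrier_mat[of "M\<^sup>T" n n A n]
    by (simp add: scalar_prod_def atLeast0LessThan del: assoc_mult_mat)
  also have "\<dots> = (\<Sum>i<n. \<Sum>j<n. M $$ (i, k) * A $$ (i, j) * M $$ (j, l))"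
    unfolding sum_distrib_right by (rule sum.swap)
  finally show ?thesis .
qed

lemma orth_entries:
  assumes n: "n = 2 * m + 2" and M: "M \<in> orth_unitriangular m a" and kl: "k < n" "l < n"
  shows "(\<Sum>i<n. \<Sum>j<n. M $$ (i, k) * Y_form m a $$ (i, j) * M $$ (j, l)) = Y_form m a $$ (k, l)"
proof -
  have "M \<in> carrier_mat n n" "M\<^sup>T * Y_form m a * M = Y_form m a"
    using M by (auto simp: orth_unitriangular_def unitriangular_def n)
  then show ?thesis
    using congruence_index[OF _ Y_form_carrier[of m a, folded n] kl, of M] by argo
qed

text \<open>This is M^T Y M = Y, read entrywise after mapping to the larger ring. The two vectors
  are independent of each other, so one of them can be a Frobenius power of the other.\<close>

lemma bil_form_invariant:
  assumes "comm_ring_hom \<iota>" and n: "n = 2 * m + 2" and M: "M \<in> orth_unitriangular m a"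
    and u: "\<And>i. i < n \<Longrightarrow> u' (i + 1) = (\<Sum>k<n. \<iota> (M $$ (i, k)) * u (k + 1))"
    and v: "\<And>i. i < n \<Longrightarrow> v' (i + 1) = (\<Sum>k<n. \<iota> (M $$ (i, k)) * v (k + 1))"
  shows "bil_form m (\<iota> a) u' v' = bil_form m (\<iota> a) u v"
proof -
  interpret comm_ring_hom \<iota> by fact
  let ?Y = "\<lambda>i j. Y_form m a $$ (i, j)"
  have "bil_form m (\<iota> a) u' v' = (\<Sum>i<n. \<Sum>j<n. \<iota> (?Y i j) *
      (\<Sum>k<n. \<iota> (M $$ (i, k)) * u (k + 1)) * (\<Sum>l<n. \<iota> (M $$ (j, l)) * v (l + 1)))"
    unfolding bil_form_eq_Y_form[OF assms(1) n]
    by (intro sum.cong refl arg_cong2[where f = "(*)"] u v) auto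
  also have "\<dots> = (\<Sum>i<n. \<Sum>j<n. \<Sum>k<n. \<Sum>l<n.
      \<iota> (M $$ (i, k) * ?Y i j * M $$ (j, l)) * u (k + 1) * v (l + 1))"
  proof -
    have "c * sum f S * sum g S = (\<Sum>k\<in>S. \<Sum>l\<in>S. c * f k * g l)" for c :: 'b and f g and S :: "nat set"
      by (subst mult.assoc, subst sum_product) (simp only: sum_distrib_left mult.assoc)
    note 1 = this
    show ?thesis unfolding 1 by (simp only: hom_mult mult_ac)
  qed
  also have "\<dots> = (\<Sum>k<n. \<Sum>l<n. \<Sum>i<n. \<Sum>j<n.
      \<iota> (M $$ (i, k) * ?Y i j * M $$ (j, l)) * u (k + 1) * v (l + 1))"
  proof -
    have "(\<Sum>i\<in>S. \<Sum>j\<in>S. \<Sum>k\<in>S. \<Sum>l\<in>S. f i j k l) = (\<Sum>k\<in>S. \<Sum>l\<in>S. \<Sum>i\<in>S. \<Sum>j\<in>S. f i j k l)"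
      for f :: "nat \<Rightarrow> nat \<Rightarrow> nat \<Rightarrow> nat \<Rightarrow> 'b" and S
    proof -
      have "(\<Sum>i\<in>S. \<Sum>j\<in>S. \<Sum>k\<in>S. \<Sum>l\<in>S. f i j k l) =
        (\<Sum>x\<in>S\<times>S. \<Sum>y\<in>S\<times>S. f (fst x) (snd x) (fst y) (snd y))"
        by (simp only: sum.cartesian_product' fst_conv snd_conv)
      also have "\<dots> = (\<Sum>y\<in>S\<times>S. \<Sum>x\<in>S\<times>S. f (fst x) (snd x) (fst y) (snd y))"
        by (rule sum.swap)
      also have "\<dots> = (\<Sum>k\<in>S. \<Sum>l\<in>S. \<Sum>i\<in>S. \<Sum>j\<in>S. f i j k l)"
        by (simp only: sum.cartesian_product' fst_conv snd_conv)
      finally show ?thesis .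
    qed
    then show ?thesis .
  qed
  also have "\<dots> = (\<Sum>k<n. \<Sum>l<n.
      \<iota> (\<Sum>i<n. \<Sum>j<n. M $$ (i, k) * ?Y i j * M $$ (j, l)) * u (k + 1) * v (l + 1))"
    by (simp only: hom_sum sum_distrib_right)
  also have "\<dots> = (\<Sum>k<n. \<Sum>l<n. \<iota> (?Y k l) * u (k + 1) * v (l + 1))"
    by (intro sum.cong refl) (simp add: orth_entries[OF n M])
  finally show ?thesis unfolding bil_form_eq_Y_form[OF assms(1) n] .
qed


section \<open>The unipotent orthogonal group\<close>

lemma finite_carrier_mat: "finite (carrier_mat n k :: 'a::finite mat set)"
proof (rule finite_subset)
  show "carrier_mat n k \<subseteq> (\<lambda>f. mat n k f) ` (({..<n} \<times> {..<k}) \<rightarrow>\<^sub>E (UNIV :: 'a set))"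
  proof
    fix M :: "'a mat" assume M: "M \<in> carrier_mat n k"
    then have "M = mat n k (restrict (\<lambda>x. M $$ x) ({..<n} \<times> {..<k}))"
      by (intro eq_matI) auto
    then show "M \<in> (\<lambda>f. mat n k f) ` (({..<n} \<times> {..<k}) \<rightarrow>\<^sub>E (UNIV :: 'a set))"
      by (rule image_eqI[of _ _ "restrict (\<lambda>x. M $$ x) ({..<n} \<times> {..<k})"]) auto
  qed
  show "finite ((\<lambda>f. mat n k f) ` (({..<n} \<times> {..<k}) \<rightarrow>\<^sub>E (UNIV :: 'a set)))"
    by (intro finite_imageI finite_PiE) auto
qed

section \<open>Closure of the group under products and inverses\<close>

lemma unitriangular_mult:
  assumes A: "A \<in> unitriangular n" and B: "B \<in> unitriangular n"
  shows "A * B \<in> unitriangular n"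
proof -
  have c: "A \<in> carrier_mat n n" "B \<in> carrier_mat n n" using A B by (auto simp: unitriangular_def)
  have e: "(A * B) $$ (i, j) = (\<Sum>k<n. A $$ (i, k) * B $$ (k, j))" if "i < n" "j < n" for i j
    using that c by (simp add: scalar_prod_def atLeast0LessThan)
  have z: "A $$ (i, k) * B $$ (k, j) = (if k = i \<and> i = j then 1 else 0)" 
    if ij: "i < n" "j < n" "i \<le> j" "k < n" for i j k
  proof (cases "i < k")
    case False
    then consider "k < j" | "k = i" "k = j" using ij by linarith
    then show ?thesis using ij A B unfolding unitriangular_def by cases auto
  qed (use ij A in \<open>auto simp: unitriangular_def\<close>)
  have "(A * B) $$ (i, j) = (if i = j then 1 else 0)" if "i < n" "j < n" "i \<le> j" for i j
  proof -
    have "(A * B) $$ (i, j) = (\<Sum>k<n. if k = i then (if i = j then 1 else 0) else 0)"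
      unfolding e[OF that(1,2)] by (rule sum.cong) (use z[OF that] in auto)
    then show ?thesis using that by simp
  qed
  then show ?thesis using c by (auto simp: unitriangular_def)
qed

text \<open>Forward substitution: for i <= j, all terms of entry (i, j) of A * B except the one with
  k = i vanish, by triangularity of \<open>A\<close> or by the rows of \<open>B\<close> already
  treated.\<close>

lemma unitriangular_right_inverse:
  assumes A: "A \<in> unitriangular n" and B: "B \<in> carrier_mat n n" and AB: "A * B = 1\<^sub>m n"
  shows "B \<in> unitriangular n"
proof -
  have c: "A \<in> carrier_mat n n" using A by (auto simp: unitriangular_def)
  have "i < n \<Longrightarrow> j < n \<Longrightarrow> i \<le> j \<Longrightarrow> B $$ (i, j) = (if i = j then 1 else 0)" for i j
  proof (induction i rule: less_induct)
    case (less i)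
    have "A $$ (i, k) * B $$ (k, j) = (if k = i then B $$ (i, j) else 0)" if "k < n" for k
      using that less A unfolding unitriangular_def by (cases k i rule: linorder_cases) auto
    then have "(\<Sum>k<n. A $$ (i, k) * B $$ (k, j)) = (\<Sum>k<n. if k = i then B $$ (i, j) else 0)"
      by (intro sum.cong) auto
    moreover have "(A * B) $$ (i, j) = (\<Sum>k<n. A $$ (i, k) * B $$ (k, j))"
      using less.prems c B by (simp add: scalar_prod_def atLeast0LessThan)
    ultimately show ?case using AB less.prems by simp
  qed
  then show ?thesis using B by (auto simp: unitriangular_def)
qed

lemma unitriangular_mat_inverse:
  assumes A: "A \<in> unitriangular n"
  obtains B where "mat_inverse A = Some B" "A * B = 1\<^sub>m n" "B * A = 1\<^sub>m n" "B \<in> carrier_mat n n"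
proof -
  have c: "A \<in> carrier_mat n n" using A by (auto simp: unitriangular_def)
  have "det A = prod_list (diag_mat A)"
    by (rule det_lower_triangular[OF _ c]) (use A in \<open>auto simp: unitriangular_def\<close>)
  also have "\<dots> = (\<Prod>i<n. A $$ (i, i))" using c by (simp add: prod_list_diag_prod atLeast0LessThan)
  also have "\<dots> = 1" using A by (intro prod.neutral) (auto simp: unitriangular_def)
  finally have "A \<in> Units (ring_mat TYPE('a) n ())" using c by (intro det_non_zero_imp_unit) simp_all
  then have "mat_inverse A \<noteq> None" using mat_inverse(1)[OF c, where b = "()"] by blast
  then obtain B where "mat_inverse A = Some B" by blast
  then show thesis using that mat_inverse(2)[OF c] by blast
qed

lemma orth_carrier: "M \<in> orth_unitriangular m a \<Longrightarrow> M \<in> carrier_mat (2 * m + 2) (2 * m + 2)"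
  by (auto simp: orth_unitriangular_def unitriangular_def)

lemma one_in_orth: "1\<^sub>m (2 * m + 2) \<in> orth_unitriangular m a"
  using Y_form_carrier[of m a] by (auto simp: orth_unitriangular_def unitriangular_def)

lemma orth_mult:
  assumes A: "A \<in> orth_unitriangular m a" and B: "B \<in> orth_unitriangular m a"
  shows "A * B \<in> orth_unitriangular m a"
proof -
  note c = orth_carrier[OF A] orth_carrier[OF B] Y_form_carrier[of m a]
  have "(A * B)\<^sup>T * Y_form m a * (A * B) = B\<^sup>T * (A\<^sup>T * Y_form m a * A) * B"
    using c by (simp add: transpose_mult[OF c(1,2)] assoc_mult_mat[of _ "2*m+2" "2*m+2" _ "2*m+2" _ "2*m+2"])
  also have "\<dots> = Y_form m a" using A B by (simp add: orth_unitriangular_def)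
  finally show ?thesis using A B unitriangular_mult by (auto simp: orth_unitriangular_def)
qed

lemma orth_inverse:
  assumes A: "A \<in> orth_unitriangular m a"
  obtains B where "mat_inverse A = Some B" "B \<in> orth_unitriangular m a" "A * B = 1\<^sub>m (2 * m + 2)"
    "B * A = 1\<^sub>m (2 * m + 2)"
proof -
  have u: "A \<in> unitriangular (2 * m + 2)" using A by (auto simp: orth_unitriangular_def)
  obtain B where B: "mat_inverse A = Some B" "A * B = 1\<^sub>m (2 * m + 2)" "B * A = 1\<^sub>m (2 * m + 2)"
    "B \<in> carrier_mat (2 * m + 2) (2 * m + 2)"
    using unitriangular_mat_inverse[OF u] by blast
  note c = orth_carrier[OF A] B(4) Y_form_carrier[of m a]
  have "B\<^sup>T * Y_form m a * B = B\<^sup>T * (A\<^sup>T * Y_form m a * A) * B"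
    using A by (simp add: orth_unitriangular_def)
  also have "\<dots> = (A * B)\<^sup>T * Y_form m a * (A * B)"
    using c by (simp add: transpose_mult[OF c(1,2)] assoc_mult_mat[of _ "2*m+2" "2*m+2" _ "2*m+2" _ "2*m+2"])
  also have "\<dots> = Y_form m a" using c by (simp add: B)
  finally have "B \<in> orth_unitriangular m a"
    using unitriangular_right_inverse[OF u B(4,2)] by (auto simp: orth_unitriangular_def)
  then show thesis using that B by blast
qed

text \<open>The group is closed under inverses, so the inverse in the definition of the action
  merely permutes the transformations obtained. Elements can therefore be prescribed by the rows of
  \<open>M\<close> directly.\<close>

lemma act_image_orth:
  "act ` orth_unitriangular m a = (\<lambda>M. subst (lin_var M)) ` orth_unitriangular m a"
proof (intro equalityI subsetI)
  fix \<tau> assume "\<tau> \<in> act ` orth_unitriangular m a"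
  then obtain g where g: "g \<in> orth_unitriangular m a" "\<tau> = act g" by auto
  obtain M where M: "mat_inverse g = Some M" "M \<in> orth_unitriangular m a" using orth_inverse[OF g(1)] by blast
  then show "\<tau> \<in> (\<lambda>M. subst (lin_var M)) ` orth_unitriangular m a"
    using act_eq_subst_lin_var[OF orth_carrier[OF g(1)] M(1)] g by auto
next
  fix \<tau> assume "\<tau> \<in> (\<lambda>M. subst (lin_var M)) ` orth_unitriangular m a"
  then obtain M where M: "M \<in> orth_unitriangular m a" "\<tau> = subst (lin_var M)" by auto
  obtain g where g: "g \<in> orth_unitriangular m a" "M * g = 1\<^sub>m (2 * m + 2)" using orth_inverse[OF M(1)] by blast
  obtain M' where M': "mat_inverse g = Some M'" "M' \<in> orth_unitriangular m a" "g * M' = 1\<^sub>m (2 * m + 2)"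
    using orth_inverse[OF g(1)] by blast
  note c = orth_carrier[OF M(1)] orth_carrier[OF g(1)] orth_carrier[OF M'(2)]
  have "M = M * (g * M')" using c M' by simp
  also have "\<dots> = (M * g) * M'" using c by (simp add: assoc_mult_mat)
  also have "\<dots> = M'" using c g by simp
  finally have "\<tau> = act g" using act_eq_subst_lin_var[OF c(2) M'(1)] M by simp
  then show "\<tau> \<in> act ` orth_unitriangular m a" using g(1) by (rule image_eqI)
qed

lemma act_orth_hom:
  assumes "g \<in> orth_unitriangular m a"
  shows "comm_ring_hom (act g)" "act g f = 0 \<Longrightarrow> f = 0" "f \<in> coord_ring (2 * m + 2) \<Longrightarrow> act g f \<in> coord_ring (2 * m + 2)"
proof -
  obtain M where M: "mat_inverse g = Some M" "M \<in> orth_unitriangular m a" "g * M = 1\<^sub>m (2 * m + 2)"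
    using orth_inverse[OF assms(1)] by blast
  note c = orth_carrier[OF assms(1)] orth_carrier[OF M(2)]
  have act: "act g = subst (lin_var M)" by (rule act_eq_subst_lin_var[OF c(1) M(1)])
  show "comm_ring_hom (act g)" unfolding act by (rule subst_hom)
  show "f \<in> coord_ring (2 * m + 2) \<Longrightarrow> act g f \<in> coord_ring (2 * m + 2)"
    unfolding act by (rule subst_lin_var_coord_ring[OF c(2)])
  assume "act g f = 0"
  then have "subst (lin_var M) f = 0" by (simp add: act)
  obtain B where B: "B \<in> orth_unitriangular m a" "M * B = 1\<^sub>m (2 * m + 2)" using orth_inverse[OF M(2)] by blast
  have "subst (lin_var B) (subst (lin_var M) f) = f"
    using subst_lin_var_mult[OF orth_carrier[OF B(1)] c(2)] by (simp add: B subst_lin_var_one)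
  then show "f = 0" using \<open>subst (lin_var M) f = 0\<close> by simp
qed

lemma act_orth_comp:
  assumes "g \<in> orth_unitriangular m a" "g' \<in> orth_unitriangular m a"
  shows "\<exists>g''\<in>orth_unitriangular m a. \<forall>f. act g'' f = act g (act g' f)"
proof -
  obtain M where M: "M \<in> orth_unitriangular m a" "act g = subst (lin_var M)"
    using act_image_orth[of m a] assms(1) by blast
  obtain M' where M': "M' \<in> orth_unitriangular m a" "act g' = subst (lin_var M')"
    using act_image_orth[of m a] assms(2) by blast
  have "subst (lin_var (M' * M)) \<in> act ` orth_unitriangular m a"
    unfolding act_image_orth using orth_mult[OF M'(1) M(1)] by blast
  then obtain g'' where "g'' \<in> orth_unitriangular m a" "act g'' = subst (lin_var (M' * M))" by auto
  then show ?thesis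
    using subst_lin_var_mult[OF orth_carrier[OF M(1)] orth_carrier[OF M'(1)]] M M'
    by (intro bexI[of _ g'']) simp_all
qed

lemma act_orth_one: "\<exists>g\<in>orth_unitriangular m a. \<forall>f. act g f = f"
proof -
  have "subst (lin_var (1\<^sub>m (2 * m + 2))) \<in> act ` orth_unitriangular m a"
    unfolding act_image_orth using one_in_orth by blast
  then obtain g where "g \<in> orth_unitriangular m a" "act g = subst (lin_var (1\<^sub>m (2 * m + 2)))" by auto
  then show ?thesis by (intro bexI[of _ g]) (simp_all add: subst_lin_var_one)
qed

text \<open>A group element maps the finite orbit injectively into itself, hence permutes the
  factors.\<close>

lemma act_orbit_prod_invariant:
  fixes a :: "'a::{field,finite}"
  assumes g: "g \<in> orth_unitriangular m a"
  shows "act g (\<Prod>y\<in>(\<lambda>g. act g f) ` orth_unitriangular m a. y) = (\<Prod>y\<in>(\<lambda>g. act g f) ` orth_unitriangular m a. y)"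
proof -
  let ?O = "(\<lambda>g. act g f) ` orth_unitriangular m a"
  interpret comm_ring_hom "act g" using act_orth_hom(1)[OF g] .
  have inj: "inj_on (act g) ?O"
  proof (rule inj_onI)
    fix x y assume "act g x = act g y"
    then have "act g (x - y) = 0" by (simp add: hom_distribs)
    then show "x = y" using act_orth_hom(2)[OF g, of "x - y"] by simp
  qed
  have fin: "finite ?O"
    using finite_subset[OF _ finite_carrier_mat] orth_carrier by (intro finite_imageI) blast
  have "act g ` ?O \<subseteq> ?O" using act_orth_comp[OF g] by (auto simp: image_iff) metis
  then have eq: "act g ` ?O = ?O" using endo_inj_surj[OF fin _ inj] by simp
  have "act g (\<Prod>y\<in>?O. y) = (\<Prod>y\<in>?O. act g y)" by (rule hom_prod)
  also have "\<dots> = (\<Prod>y\<in>act g ` ?O. y)" by (simp add: prod.reindex[OF inj])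
  finally show ?thesis by (simp only: eq)
qed


text \<open>The matrix of \<open>x\<^sub>s \<mapsto> x\<^sub>s + c x\<^sub>j\<close>, \<open>x\<^sub>j\<^sub>' \<mapsto> x\<^sub>j\<^sub>' - c y(x\<^sub>s, -) - c\<^sup>2 Q x\<^sub>j\<close>, i.e. of the Eichler
  transformation attached to the isotropic vector dual to \<open>x\<^sub>j\<close>.\<close>

lemma eichler_preserves_form:
  fixes y M :: "nat \<Rightarrow> nat \<Rightarrow> 'a::comm_ring_1"
  assumes sym: "\<And>i k. i < n \<Longrightarrow> k < n \<Longrightarrow> y i k = y k i"
    and yj: "\<And>i. i < n \<Longrightarrow> y i j' = (if i = j then 1 else 0)"
    and ne: "s \<noteq> j" "j \<noteq> j'" "s \<noteq> j'" and lt: "s < n" "j < n" "j' < n" and Q: "2 * Q = y s s"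
    and M: "\<And>i k. i < n \<Longrightarrow> k < n \<Longrightarrow> M i k = (if i = k then 1 else 0) + (if i = s then if k = j then c else 0 else 0)
        + (if i = j' then - c * y s k - (if k = j then c\<^sup>2 * Q else 0) else 0)"
    and pr: "p < n" "r < n"
  shows "(\<Sum>i<n. \<Sum>k<n. M i p * y i k * M k r) = y p r"
proof -
  \<comment> \<open>\<open>P\<close> is column \<open>r\<close> of the product of the form with
    \<open>M\<close>, simplified because column \<open>j'\<close> of the form has its only nonzero
    entry in row \<open>j\<close>.\<close>
  define P where "P i = y i r + (if r = j then c * y i s else 0)
      - (if i = j then c * y s r + (if r = j then c\<^sup>2 * Q else 0) else 0)" for i
  have P: "(\<Sum>k<n. y i k * M k r) = P i" if i: "i < n" for i
  proof -
    have "(\<Sum>k<n. y i k * M k r) = (\<Sum>k<n. (if k = r then y i r else 0)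
        + (if k = s then if r = j then c * y i s else 0 else 0)
        + (if k = j' then y i j' * (- c * y s r - (if r = j then c\<^sup>2 * Q else 0)) else 0))"
      by (rule sum.cong) (use pr i in \<open>auto simp: M algebra_simps\<close>)
    also have "\<dots> = P i" using lt pr i by (simp add: sum.distrib yj P_def)
    finally show ?thesis .
  qed
  have "(\<Sum>i<n. \<Sum>k<n. M i p * y i k * M k r) = (\<Sum>i<n. M i p * P i)"
    by (rule sum.cong) (simp_all add: mult.assoc P flip: sum_distrib_left)
  also have "\<dots> = (\<Sum>i<n. (if i = p then P p else 0) + (if i = s then if p = j then c * P s else 0 else 0)
        + (if i = j' then (- c * y s p - (if p = j then c\<^sup>2 * Q else 0)) * P j' else 0))"
    by (rule sum.cong) (use pr in \<open>auto simp: M algebra_simps\<close>)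
  also have "\<dots> = P p + (if p = j then c * P s else 0) + (- c * y s p - (if p = j then c\<^sup>2 * Q else 0)) * P j'"
    using lt pr by (simp add: sum.distrib)
  also have "P s = y s r + (if r = j then c * (2 * Q) else 0)" using ne by (simp add: P_def Q)
  also have "P j' = (if r = j then 1 else 0)"
    using ne lt pr sym[of j' r] sym[of j' s] by (simp add: P_def yj)
  also have "P p + (if p = j then c * (y s r + (if r = j then c * (2 * Q) else 0)) else 0)
      + (- c * y s p - (if p = j then c\<^sup>2 * Q else 0)) * (if r = j then 1 else 0) = y p r"
    using sym[OF pr(1) lt(1)] by (auto simp: P_def algebra_simps power2_eq_square mult_2)
  finally show ?thesis .
qed

lemma lin_var_row:
  assumes "dim_row M = n" "1 \<le> i" "i \<le> n"
    and "\<And>k. k < n \<Longrightarrow> M $$ (i - 1, k) = (if k = i - 1 then 1 else 0) + e (k + 1)"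
  shows "lin_var M i = Var i + (\<Sum>j = 1..n. Const (e j) * Var j)"
proof -
  have "lin_var M i = (\<Sum>j = 1..n. Const (M $$ (i - 1, j - 1)) * Var j)"
    using assms(1-3) by (simp add: lin_var_def)
  also have "\<dots> = (\<Sum>j = 1..n. (if j = i then Var i else 0) + Const (e j) * Var j)"
  proof (rule sum.cong)
    fix j assume j: "j \<in> {1..n}"
    then have "j - 1 = i - 1 \<longleftrightarrow> j = i" "j - 1 + 1 = j" "j - 1 < n" using assms(2) by auto
    then show "Const (M $$ (i - 1, j - 1)) * Var j = (if j = i then Var i else 0) + Const (e j) * Var j"
      using assms(4)[of "j - 1"] by (auto simp: Const.hom_add Const.hom_one distrib_right)
  qed simp
  also have "\<dots> = Var i + (\<Sum>j = 1..n. Const (e j) * Var j)" using assms(2,3) by (simp add: sum.distrib)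
  finally show ?thesis .
qed

text \<open>The Eichler transformation changes only x_s and the partner of x_j. The condition on j +
  s places this partner after x_s, so all earlier coordinates stay fixed.\<close>

lemma root_element_exists:
  fixes a c :: "'a::field"
  assumes "1 \<le> j" "j < s" "j + s < 2 * m + 3"
  shows "\<exists>M\<in>orth_unitriangular m a. (\<forall>i. 1 \<le> i \<longrightarrow> i < s \<longrightarrow> lin_var M i = Var i) \<and>
    lin_var M s = Var s + Const c * Var j"
proof -
  define n where n: "n = 2 * m + 2"
  define s0 j0 where "s0 = s - 1" and "j0 = j - 1"
  \<comment> \<open>From here on indices start at 0, where dual indices add up to 2m + 1.\<close>
  define j' where "j' = 2 * m + 1 - j0"
  have ord: "s = s0 + 1" "j = j0 + 1" "j0 < s0" "s0 < j'" "j0 < m" "j' < n" "s0 < n" "j0 < n" "j0 + j' = 2 * m + 1" "m + 1 < j'"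
    using assms by (auto simp: s0_def j0_def j'_def n)
  note Yi = Y_form_index[of _ m _ a, folded n]
  define y where "y i k = Y_form m a $$ (i, k)" for i k
  \<comment> \<open>The value of h_1 at the basis vector with index \<open>s0\<close>. It satisfies
    2 Q = y(s, s) without a division by 2.\<close>
  define Q where "Q = (if s0 = m then 1 else if s0 = m + 1 then a else 0)"
  define M where "M = mat n n (\<lambda>(i, k). (if i = k then 1 else 0) + (if i = s0 then if k = j0 then c else 0 else 0)
        + (if i = j' then - c * y s0 k - (if k = j0 then c\<^sup>2 * Q else 0) else 0))"
  have Mi: "M $$ (i, k) = (if i = k then 1 else 0) + (if i = s0 then if k = j0 then c else 0 else 0)
        + (if i = j' then - c * y s0 k - (if k = j0 then c\<^sup>2 * Q else 0) else 0)" if "i < n" "k < n" for i k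
    using that by (simp add: M_def)
  have Mc: "M \<in> carrier_mat n n" by (simp add: M_def)
  \<comment> \<open>Row \<open>j'\<close> of \<open>M\<close> contains a multiple of row
    \<open>s0\<close> of the form; its vanishing from column \<open>j'\<close> onwards is what makes
    \<open>M\<close> lower unitriangular.\<close>
  have yz: "y s0 k = 0" if "k < n" "j' \<le> k" for k
    using that ord by (auto simp: y_def Yi)
  have "M \<in> unitriangular n" unfolding unitriangular_def
  proof (intro CollectI conjI allI impI)
    fix i assume i: "i < n"
    show "M $$ (i, i) = 1" using i ord by (auto simp: Mi yz)
  next
    fix i k assume ik: "i < n" "k < n" "i < k"
    show "M $$ (i, k) = 0" using ik ord by (auto simp: Mi yz)
  qed (rule Mc)
  moreover have "M\<^sup>T * Y_form m a * M = Y_form m a"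
  proof (rule eq_matI)
    note Yc = Y_form_carrier[of m a, folded n]
    show "dim_row (M\<^sup>T * Y_form m a * M) = dim_row (Y_form m a)"
      "dim_col (M\<^sup>T * Y_form m a * M) = dim_col (Y_form m a)" using Mc Yc by auto
    fix p r assume "p < dim_row (Y_form m a)" "r < dim_col (Y_form m a)"
    then have pr: "p < n" "r < n" using Yc by auto
    have "(M\<^sup>T * Y_form m a * M) $$ (p, r) = (\<Sum>i<n. \<Sum>k<n. M $$ (i, p) * y i k * M $$ (k, r))"
      unfolding y_def by (rule congruence_index[OF Mc Yc pr])
    also have "\<dots> = y p r"
    proof (rule eichler_preserves_form[where j = j0 and j' = j' and s = s0 and Q = Q and c = c])
      show "y i k = y k i" if "i < n" "k < n" for i k
        using that Y_form_sym[of i m k a] by (simp add: y_def n)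
      show "y i j' = (if i = j0 then 1 else 0)" if "i < n" for i
        using that ord by (auto simp: y_def Yi)
      show "2 * Q = y s0 s0" using ord by (auto simp: y_def Yi Q_def)
    qed (use ord pr in \<open>auto simp: Mi\<close>)
    finally show "(M\<^sup>T * Y_form m a * M) $$ (p, r) = Y_form m a $$ (p, r)" by (simp add: y_def)
  qed
  ultimately have "M \<in> orth_unitriangular m a" by (simp add: orth_unitriangular_def n)
  moreover have "lin_var M i = Var i" if "1 \<le> i" "i < s" for i
    using that ord Mc by (subst lin_var_row[where n = n and e = "\<lambda>_. 0"]) (auto simp: Mi Const.hom_zero)
  moreover have "lin_var M s = Var s + Const c * Var j"
  proof -
    have "lin_var M s = Var s + (\<Sum>k = 1..n. Const (if k = j then c else 0) * Var k)"
      using ord Mc by (intro lin_var_row) (auto simp: Mi)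
    also have "(\<Sum>k = 1..n. Const (if k = j then c else 0) * Var k) = (\<Sum>k = 1..n. if k = j then Const c * Var j else 0)"
      by (rule sum.cong) (auto simp: Const.hom_zero)
    also have "\<dots> = Const c * Var j" using ord assms(1) by simp
    finally show ?thesis .
  qed
  ultimately show ?thesis by blast
qed

text \<open>By triangularity, entry (m, m+1) of M^T Y M reduces to 1 + 2a M(m+1, m), and it must
  equal 1. Consequently x_{m+1} does not occur in the orbit of x_{m+2}.\<close>

lemma orth_middle_entry:
  fixes a :: "'a::field"
  assumes M: "M \<in> orth_unitriangular m a" and a: "2 * a \<noteq> 0"
  shows "M $$ (m + 1, m) = 0"
proof -
  define n where n: "n = 2 * m + 2"
  have u: "M \<in> unitriangular n" using M by (simp add: orth_unitriangular_def n)
  have diag: "M $$ (i, i) = 1" if "i < n" for i using u that by (auto simp: unitriangular_def)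
  have low: "M $$ (i, k) = 0" if "i < n" "k < n" "i < k" for i k using u that by (auto simp: unitriangular_def)
  note Yi = Y_form_index[of _ m _ a, folded n]
  have mn: "m < n" "m + 1 < n" by (auto simp: n)
  have row: "(\<Sum>k<n. M $$ (i, m) * Y_form m a $$ (i, k) * M $$ (k, m + 1)) =
      (if i = m then 1 else 0) + (if i = m + 1 then 2 * a * M $$ (m + 1, m) else 0)" if i: "i < n" for i
  proof (cases "i < m")
    case True
    then show ?thesis using low[OF i, of m] mn by simp
  next
    case False
    have "M $$ (i, m) * Y_form m a $$ (i, k) * M $$ (k, m + 1) =
      (if k = m + 1 then (if i = m then 1 else 0) + (if i = m + 1 then 2 * a * M $$ (m + 1, m) else 0) else 0)"
      if k: "k < n" for k
    proof (cases k "m + 1" rule: linorder_cases)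
      case less
      then show ?thesis using low[OF k, of "m + 1"] mn by simp
    next
      case equal
      then show ?thesis using False i mn diag by (auto simp: Yi)
    next
      case greater
      then show ?thesis using False i k by (auto simp: Yi)
    qed
    then have "(\<Sum>k<n. M $$ (i, m) * Y_form m a $$ (i, k) * M $$ (k, m + 1)) =
      (\<Sum>k<n. if k = m + 1 then (if i = m then 1 else 0) + (if i = m + 1 then 2 * a * M $$ (m + 1, m) else 0) else 0)"
      by (intro sum.cong) auto
    then show ?thesis using mn by simp
  qed
  have "Y_form m a $$ (m, m + 1) = (\<Sum>i<n. \<Sum>k<n. M $$ (i, m) * Y_form m a $$ (i, k) * M $$ (k, m + 1))"
    by (rule orth_entries[OF n M mn, symmetric])
  also have "\<dots> = (\<Sum>i<n. (if i = m then 1 else 0) + (if i = m + 1 then 2 * a * M $$ (m + 1, m) else 0))"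
    by (rule sum.cong) (simp_all only: lessThan_iff row)
  also have "\<dots> = 1 + 2 * a * M $$ (m + 1, m)" using mn by (simp add: sum.distrib)
  finally have "2 * a * M $$ (m + 1, m) = 0" using mn by (simp add: Yi)
  then show ?thesis using a by simp
qed

text \<open>This bounds the orbit of x_i from above. For i = m + 2 the bound is m instead of m + 1
  because of \<open>orth_middle_entry\<close>.\<close>

lemma orth_lin_var_form:
  fixes a :: "'a::field"
  assumes M: "M \<in> orth_unitriangular m a" and a: "2 * a \<noteq> 0" and i: "1 \<le> i" "i \<le> m + 2"
  shows "\<exists>e. lin_var M i = Var i + (\<Sum>j = 1..min (i - 1) m. Const (e j) * Var j)"
proof -
  define n where n: "n = 2 * m + 2"
  have u: "M \<in> unitriangular n" using M by (simp add: orth_unitriangular_def n)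
  define e where "e j = (if j < i \<and> j \<le> m then M $$ (i - 1, j - 1) else 0)" for j
  have "M $$ (i - 1, k) = (if k = i - 1 then 1 else 0) + e (k + 1)" if k: "k < n" for k
  proof -
    consider "k < i - 1" "k < m" | "k < i - 1" "k = m" "i - 1 = m + 1" | "k = i - 1" | "k > i - 1"
      using i by linarith
    then show ?thesis
      using u k i orth_middle_entry[OF M a] by cases (auto simp: e_def unitriangular_def n)
  qed
  then have "lin_var M i = Var i + (\<Sum>j = 1..n. Const (e j) * Var j)"
    using u i by (intro lin_var_row) (auto simp: unitriangular_def n)
  also have "(\<Sum>j = 1..n. Const (e j) * Var j) = (\<Sum>j = 1..min (i - 1) m. Const (e j) * Var j)"
    by (rule sum.mono_neutral_right) (use i in \<open>auto simp: e_def n Const.hom_zero\<close>)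
  finally show ?thesis by blast
qed


section \<open>The function field\<close>

definition emb :: "'a::field \<Rightarrow> 'a mpoly fract" where
  "emb c = to_fract (Const c)"

definition coord :: "nat \<Rightarrow> 'a::field mpoly fract" where
  "coord i = to_fract (Var i)"

lemma emb_embedding: "finite_field_embedding (emb :: 'a::{field,finite} \<Rightarrow> _) CARD('a)"
  by unfold_locales (simp_all add: emb_def hom_distribs Const.hom_one)

lemma lookup_Const_mult_Var:
  "Poly_Mapping.lookup (Const c * Var j) (Poly_Mapping.single k 1) = (if j = k then c else 0)"
proof -
  have "Poly_Mapping.single j (1::nat) = Poly_Mapping.single k 1 \<longleftrightarrow> j = k"
    by (metis keys_single one_neq_zero singleton_inject)
  then show ?thesis by (auto simp: Const_def Var_def mult_single lookup_single when_def)
qed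

text \<open>Every element of the span of x_1, ..., x_i is a polynomial in which the coefficient of
  x_{i+1} is 0.\<close>

lemma coord_notin_span_set: "coord (Suc i) \<notin> span_set emb (coord :: nat \<Rightarrow> 'a::{field,finite} mpoly fract) i"
proof
  interpret finite_field_embedding "emb :: 'a \<Rightarrow> _" "CARD('a)" by (rule emb_embedding)
  let ?v = "Poly_Mapping.single (Suc i) (1::nat)"
  assume "coord (Suc i) \<in> span_set emb (coord :: nat \<Rightarrow> 'a mpoly fract) i"
  then have "\<exists>f :: 'a mpoly. coord (Suc i) = to_fract f \<and> Poly_Mapping.lookup f ?v = 0"
  proof (induction rule: span_set_induct)
    case zero
    then show ?case by (intro exI[of _ 0]) simp
  next
    case (gen c j)
    then show ?case
      by (intro exI[of _ "Const c * Var j"]) (simp add: lookup_Const_mult_Var[unfolded One_nat_def] emb_def coord_def)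
  next
    case (add u v)
    then obtain f g :: "'a mpoly" where "u = to_fract f" "Poly_Mapping.lookup f ?v = 0"
      "v = to_fract g" "Poly_Mapping.lookup g ?v = 0" by blast
    then show ?case by (intro exI[of _ "f + g"]) (simp add: lookup_add)
  qed
  then have "Poly_Mapping.lookup (Var (Suc i) :: 'a mpoly) ?v = 0" by (auto simp: coord_def)
  then show False by (simp add: Var_def)
qed

section \<open>Generated subfields and the function field\<close>

lemma inv_ring_of_type_algebra:
  assumes "(x::'b::field) \<noteq> 0"
  shows "inv\<^bsub>ring_of_type_algebra\<^esub> x = inverse x"
proof -
  interpret field "ring_of_type_algebra :: 'b ring" by (rule field_from_type_algebra)
  show ?thesis by (rule comm_inv_char) (use assms in \<open>auto simp: ring_of_type_algebra_def\<close>)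
qed

lemma a_inv_ring_of_type_algebra: "\<ominus>\<^bsub>ring_of_type_algebra\<^esub> x = - (x::'b::field)"
proof -
  interpret field "ring_of_type_algebra :: 'b ring" by (rule field_from_type_algebra)
  show ?thesis by (rule minus_equality) (auto simp: ring_of_type_algebra_def)
qed

lemma field_gen_closed:
  shows "subring_set (field_gen S)" and "x \<in> field_gen S \<Longrightarrow> inverse x \<in> field_gen S"
    and "emb c \<in> field_gen S" and "f \<in> S \<Longrightarrow> to_fract f \<in> field_gen S"
proof -
  let ?R = "ring_of_type_algebra :: 'a mpoly fract ring"
  have R: "\<one>\<^bsub>?R\<^esub> = 1" "\<zero>\<^bsub>?R\<^esub> = 0" "x \<oplus>\<^bsub>?R\<^esub> y = x + y" "x \<otimes>\<^bsub>?R\<^esub> y = x * y" for x y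
    by (simp_all add: ring_of_type_algebra_def)
  note gen = generate_field.intros[where R = ?R and H = "to_fract ` (range Const \<union> S)", folded field_gen_def,
      unfolded R a_inv_ring_of_type_algebra]
  have diff: "x - y \<in> field_gen S" if "x \<in> field_gen S" "y \<in> field_gen S" for x y
    using gen(5)[OF that(1) gen(3)[OF that(2)]] by simp
  show sub: "subring_set (field_gen S)" unfolding subring_set_def using gen(1,6) diff by blast
  show "inverse x \<in> field_gen S" if "x \<in> field_gen S" for x
    using gen(4)[OF that] subring_set_closed(1)[OF sub] by (cases "x = 0") (auto simp: inv_ring_of_type_algebra)
  show "emb c \<in> field_gen S" "f \<in> S \<Longrightarrow> to_fract f \<in> field_gen S"
    using gen(2) unfolding emb_def by auto
qed

text \<open>Minimality of the generated field. It reduces both the invariance of its elements and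
  their membership in the function field to the generators.\<close>

lemma field_gen_subset:
  assumes "subring_set K" "\<And>x. x \<in> K \<Longrightarrow> inverse x \<in> K" "\<And>c. emb c \<in> K" "\<And>f. f \<in> S \<Longrightarrow> to_fract f \<in> K"
  shows "field_gen S \<subseteq> K"
proof
  fix x assume "x \<in> field_gen S"
  then show "x \<in> K" unfolding field_gen_def
  proof (induction rule: generate_field.induct)
    case (m_inv h)
    then have "h \<noteq> 0" by (simp add: ring_of_type_algebra_def)
    then show ?case using m_inv assms(2) by (simp add: inv_ring_of_type_algebra)
  next
    case (a_inv h)
    then show ?case
      using subring_set_closed(4)[OF assms(1)] by (simp only: a_inv_ring_of_type_algebra)
  qed (use assms(3,4) subring_set_closed[OF assms(1)] in
      \<open>auto simp: ring_of_type_algebra_def emb_def\<close>)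
qed

lemma subring_set_fun_field: "subring_set (fun_field n :: 'a::field mpoly fract set)"
  unfolding subring_set_def
proof (intro conjI ballI)
  note cl = subring_set_closed[OF subring_set_coord_ring[of n]]
  show "1 \<in> (fun_field n :: 'a mpoly fract set)"
    unfolding fun_field_def One_fract_def using cl(2) by (intro CollectI exI[of _ 1]) simp
  fix x y :: "'a mpoly fract" assume "x \<in> fun_field n" "y \<in> fun_field n"
  then obtain f g f' g' where xy: "x = Fract f g" "y = Fract f' g'"
    and c: "f \<in> coord_ring n" "g \<in> coord_ring n" "f' \<in> coord_ring n" "g' \<in> coord_ring n" "g \<noteq> 0" "g' \<noteq> 0"
    unfolding fun_field_def by blast
  have "x - y = Fract (f * g' - f' * g) (g * g')" "x * y = Fract (f * f') (g * g')" using xy c by simp_all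
  moreover have "f * g' - f' * g \<in> coord_ring n" "f * f' \<in> coord_ring n" "g * g' \<in> coord_ring n" "g * g' \<noteq> 0"
    using c by (auto intro!: cl)
  ultimately show "x - y \<in> fun_field n" "x * y \<in> fun_field n" unfolding fun_field_def by blast+
qed

lemma inverse_in_fun_field: "x \<in> fun_field n \<Longrightarrow> inverse x \<in> fun_field n"
proof (cases "x = 0")
  case False
  assume "x \<in> fun_field n"
  then obtain f g where f: "x = Fract f g" "f \<in> coord_ring n" "g \<in> coord_ring n" "g \<noteq> 0"
    unfolding fun_field_def by blast
  then have "f \<noteq> 0" using False by (auto simp: eq_fract Zero_fract_def)
  then show ?thesis using f unfolding fun_field_def by auto
qed simp

lemma to_fract_in_fun_field: "f \<in> coord_ring n \<Longrightarrow> to_fract f \<in> fun_field n"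
  unfolding fun_field_def to_fract_def
  using subring_set_closed(2)[OF subring_set_coord_ring[of n]] by force

text \<open>The rings L[x_1, ..., x_s]. No inverses are adjoined, so only the elements of
  \<open>L\<close> are known to be invertible in them.\<close>

primrec tower :: "'a::field mpoly fract set \<Rightarrow> nat \<Rightarrow> 'a mpoly fract set" where
  "tower L 0 = L"
| "tower L (Suc s) = adjoin (tower L s) (coord (Suc s))"

lemma subring_set_tower: "subring_set L \<Longrightarrow> subring_set (tower L s)"
  by (induction s) (simp_all add: subring_set_adjoin)

lemma tower_mono:
  assumes "subring_set L" "r \<le> s" shows "tower L r \<subseteq> tower L s"
  using assms(2)
proof (induction rule: dec_induct)
  case (step s)
  then show ?case using adjoin_superset(1)[OF subring_set_tower[OF assms(1)], of s "coord (Suc s)"] by auto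
qed simp

lemma coord_in_tower:
  assumes "subring_set L" "1 \<le> i" "i \<le> s" shows "coord i \<in> tower L s"
proof -
  obtain k where "i = Suc k" using assms by (cases i) auto
  then have "coord i \<in> tower L i"
    using adjoin_superset(2)[OF subring_set_tower[OF assms(1)]] by simp
  then show ?thesis using tower_mono[OF assms(1,3)] by blast
qed

lemma to_fract_in_tower:
  assumes L: "subring_set L" and c: "\<And>c. emb c \<in> L" and f: "f \<in> coord_ring n"
  shows "to_fract f \<in> tower L n"
proof -
  have "subst Var f \<in> {f. to_fract f \<in> tower L n}"
  proof (rule subst_in_subring_set[OF _ _ _ f])
    show "subring_set {f. to_fract f \<in> tower L n}"
      using subring_set_closed[OF subring_set_tower[OF L, of n]] by (auto simp: subring_set_def)
    show "Const c \<in> {f. to_fract f \<in> tower L n}" for c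
      using c[of c] tower_mono[OF L, of 0 n] by (auto simp: emb_def)
    show "Var i \<in> {f. to_fract f \<in> tower L n}" if "i \<in> {1..n}" for i
      using coord_in_tower[OF L, of i n] that by (auto simp: coord_def)
  qed
  then show ?thesis by (simp add: subst_Var_id)
qed

lemma hom_fixes_adjoin:
  assumes "comm_ring_hom \<sigma>" "\<And>x. x \<in> A \<Longrightarrow> \<sigma> x = x" "\<sigma> \<theta> = \<theta>" "x \<in> adjoin A \<theta>"
  shows "\<sigma> x = x"
proof -
  interpret comm_ring_hom \<sigma> by fact
  obtain r where r: "x = poly r \<theta>" "\<And>i. coeff r i \<in> A" using assms(4) unfolding adjoin_def by blast
  have "\<sigma> (poly r \<theta>) = poly r \<theta>" unfolding poly_altdef
    by (simp add: hom_distribs assms(2)[OF r(2)] assms(3))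
  then show ?thesis using r by simp
qed

lemma hom_fixes_tower:
  assumes "comm_ring_hom \<sigma>" "\<And>x. x \<in> L \<Longrightarrow> \<sigma> x = x" "\<And>i. 1 \<le> i \<Longrightarrow> i \<le> s \<Longrightarrow> \<sigma> (coord i) = coord i"
    and "x \<in> tower L s"
  shows "\<sigma> x = x"
  using assms(3,4)
proof (induction s arbitrary: x)
  case (Suc s)
  show ?case
    by (rule hom_fixes_adjoin[OF assms(1), of "tower L s" "coord (Suc s)"]) (use Suc in auto)
qed (use assms(2) in simp)

lemma bil_form_hom:
  assumes "comm_ring_hom \<sigma>"
  shows "\<sigma> (bil_form m \<alpha> u v) = bil_form m (\<sigma> \<alpha>) (\<lambda>i. \<sigma> (u i)) (\<lambda>i. \<sigma> (v i))"
proof -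
  interpret comm_ring_hom \<sigma> by fact
  show ?thesis by (simp add: bil_form_def hom_distribs)
qed

lemma comm_ring_hom_to_fract: "comm_ring_hom to_fract"
  by unfold_locales simp_all

lemma orbit_norm_eq_prod: "to_fract (orbit_norm G i) = (\<Prod>z\<in>(\<lambda>g. to_fract (act g (Var i))) ` G. z)"
proof -
  interpret comm_ring_hom to_fract by (rule comm_ring_hom_to_fract)
  have "to_fract (orbit_norm G i) = (\<Prod>y\<in>(\<lambda>g. act g (Var i)) ` G. to_fract y)"
    unfolding orbit_norm_def by (rule hom_prod)
  also have "\<dots> = (\<Prod>z\<in>to_fract ` (\<lambda>g. act g (Var i)) ` G. z)"
    by (subst prod.reindex) (auto simp: inj_on_def)
  finally show ?thesis by (simp add: image_image)
qed


section \<open>The descent along the tower\<close>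

interpretation to_fract_hom: comm_ring_hom to_fract by (rule comm_ring_hom_to_fract)

locale minus_type =
  fixes a :: "'a::{field,finite}" and q m n :: nat and G :: "'a mat set" and L :: "'a mpoly fract set"
  assumes q: "q = CARD('a)" and q_odd: "odd q"
    and irr: "irreducible [:a, 1, 1:]"
    and n: "n = 2 * m + 2"
    and G: "G = orth_unitriangular m a"
    and L: "L = field_gen (orbit_norm G ` {1..m + 2} \<union> h q m a ` {1..m})"
begin

sublocale finite_field_embedding "emb :: 'a \<Rightarrow> _" q
  using emb_embedding unfolding q .

lemma two_neq_0: "(2::'a) \<noteq> 0"
  using two_neq_0_if_odd_CARD q q_odd by blast

lemma two_mpoly_fract_neq_0: "(2::'a mpoly fract) \<noteq> 0"
proof -
  have "emb (2::'a) \<noteq> 0" using two_neq_0 by simp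
  then show ?thesis by (simp add: hom_numeral)
qed

text \<open>For a = 0 the polynomial T^2 + T + a would split as T(T + 1).\<close>

lemma two_a_neq_0: "2 * a \<noteq> 0"
proof
  assume "2 * a = 0"
  then have "[:a, 1, 1:] = [:0, 1:] * [:1, 1:]" using two_neq_0 by simp
  then have "[:0, 1::'a:] dvd 1 \<or> [:1, 1::'a:] dvd 1" using irr irreducibleD by blast
  then show False by (simp add: is_unit_pCons_iff)
qed

lemmas L_closed = field_gen_closed[where S = "orbit_norm G ` {1..m + 2} \<union> h q m a ` {1..m}", folded L]

abbreviation span :: "nat \<Rightarrow> 'a mpoly fract set" where "span \<equiv> span_set emb coord"

abbreviation \<phi> :: "nat \<Rightarrow> 'a mpoly fract \<Rightarrow> 'a mpoly fract" where "\<phi> \<equiv> span_poly q coord"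

section \<open>Invariance of the generators\<close>

lemma act_hom: "g \<in> G \<Longrightarrow> field_hom (act_fract g)" "g \<in> G \<Longrightarrow> act_fract g (to_fract f) = to_fract (act g f)"
  using act_fract_hom[OF act_orth_hom(1)[of g m a] act_orth_hom(2)[of g m a]] unfolding G by blast+

lemma act_ring_hom: "g \<in> G \<Longrightarrow> comm_ring_hom (act_fract g)"
proof -
  assume "g \<in> G"
  then interpret \<sigma>: field_hom "act_fract g" by (rule act_hom)
  show ?thesis by unfold_locales
qed

lemma act_eq_lin_var:
  assumes "g \<in> G"
  obtains M where "M \<in> orth_unitriangular m a" "act g = subst (lin_var M)"
  using act_image_orth[of m a] assms unfolding G by blast

lemma lin_var_eq_act:
  assumes "M \<in> orth_unitriangular m a"
  obtains g where "g \<in> G" "act g = subst (lin_var M)"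
proof -
  have "subst (lin_var M) \<in> act ` orth_unitriangular m a" unfolding act_image_orth using assms by blast
  then show thesis using that unfolding G by auto
qed

lemma act_fract_emb: "g \<in> G \<Longrightarrow> act_fract g (emb c) = emb c"
  by (rule act_eq_lin_var) (auto simp: emb_def act_hom(2))

lemma h_1_coord: "2 * to_fract (h q m a 1) = bil_form m (emb a) coord coord"
  using arg_cong[OF two_h_1_eq_bil_form[of q m a], of to_fract]
  by (simp add: bil_form_hom[OF comm_ring_hom_to_fract] emb_def coord_def[abs_def]
      to_fract_hom.hom_numeral)

lemma h_coord: "k \<ge> 2 \<Longrightarrow> to_fract (h q m a k) = bil_form m (emb a) coord (\<lambda>i. coord i ^ q ^ (k - 1))"
  by (simp add: h_eq_bil_form bil_form_hom[OF comm_ring_hom_to_fract] emb_def coord_def[abs_def]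
      to_fract_hom.hom_power)

lemma act_coord_sum:
  assumes M: "M \<in> orth_unitriangular m a" and "i < n"
  shows "to_fract (lin_var M (i + 1)) = (\<Sum>k<n. emb (M $$ (i, k)) * coord (k + 1))"
proof -
  have "dim_row M = n" using orth_carrier[OF M] by (simp add: n)
  then have "to_fract (lin_var M (i + 1)) = (\<Sum>j = 1..n. emb (M $$ (i, j - 1)) * coord j)"
    using \<open>i < n\<close> by (simp add: lin_var_def emb_def coord_def)
  also have "\<dots> = (\<Sum>k<n. emb (M $$ (i, k)) * coord (k + 1))"
    by (rule sum.reindex_bij_witness[of _ Suc "\<lambda>j. j - 1"]) auto
  finally show ?thesis .
qed

text \<open>The matrix entries lie in F_q and are fixed by Frobenius, so the vector of q^j-th powers
  is transformed by the same matrix as the coordinates.\<close>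

lemma bil_form_act_invariant:
  assumes g: "g \<in> G"
  shows "act_fract g (bil_form m (emb a) coord (\<lambda>i. coord i ^ q ^ j)) = bil_form m (emb a) coord (\<lambda>i. coord i ^ q ^ j)"
proof -
  interpret \<sigma>: comm_ring_hom "act_fract g" by (rule act_ring_hom[OF g])
  obtain M where M: "M \<in> orth_unitriangular m a" "act g = subst (lin_var M)" using act_eq_lin_var[OF g] .
  have x: "act_fract g (coord (i + 1)) = (\<Sum>k<n. emb (M $$ (i, k)) * coord (k + 1))" if "i < n" for i
    using act_coord_sum[OF M(1) that] by (simp add: coord_def act_hom(2)[OF g] M(2))
  have xq: "act_fract g (coord (i + 1)) ^ q ^ j = (\<Sum>k<n. emb (M $$ (i, k)) * coord (k + 1) ^ q ^ j)" if "i < n" for i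
    by (simp only: x[OF that] frobenius_iter_sum power_mult_distrib embedding_power_q_iter)
  have emb: "comm_ring_hom (emb :: 'a \<Rightarrow> _)" by unfold_locales
  have "act_fract g (bil_form m (emb a) coord (\<lambda>i. coord i ^ q ^ j)) =
    bil_form m (emb a) (\<lambda>i. act_fract g (coord i)) (\<lambda>i. act_fract g (coord i) ^ q ^ j)"
    by (simp add: bil_form_hom[OF act_ring_hom[OF g]] act_fract_emb[OF g] \<sigma>.hom_power)
  also have "\<dots> = bil_form m (emb a) coord (\<lambda>i. coord i ^ q ^ j)"
    by (rule bil_form_invariant[OF emb n M(1)]) (erule x, erule xq)
  finally show ?thesis .
qed

lemma h_invariant:
  assumes g: "g \<in> G" and k: "k \<ge> 1"
  shows "act_fract g (to_fract (h q m a k)) = to_fract (h q m a k)"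
proof (cases "k = 1")
  case True
  interpret \<sigma>: comm_ring_hom "act_fract g" by (rule act_ring_hom[OF g])
  have "2 * act_fract g (to_fract (h q m a 1)) = act_fract g (2 * to_fract (h q m a 1))"
    by (simp only: \<sigma>.hom_mult \<sigma>.hom_numeral)
  also have "\<dots> = 2 * to_fract (h q m a 1)"
    using bil_form_act_invariant[OF g, of 0] unfolding h_1_coord by simp
  finally show ?thesis using two_mpoly_fract_neq_0 True by simp
next
  case False
  then show ?thesis using k h_coord[of k] bil_form_act_invariant[OF g, of "k - 1"] by simp
qed

lemma orbit_norm_invariant:
  assumes "g \<in> G"
  shows "act_fract g (to_fract (orbit_norm G i)) = to_fract (orbit_norm G i)"
  using act_orbit_prod_invariant[of g m a "Var i"] assms
  unfolding act_hom(2)[OF assms] orbit_norm_def G by simp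

text \<open>The fixed points of \<open>g\<close> form a field containing the constants, so only the
  generators have to be checked.\<close>

lemma L_fixed:
  assumes "g \<in> G" "x \<in> L" shows "act_fract g x = x"
proof -
  interpret \<sigma>: field_hom "act_fract g" by (rule act_hom[OF assms(1)])
  have "L \<subseteq> {x. act_fract g x = x}" unfolding L
    by (rule field_gen_subset)
      (use assms(1) in \<open>auto simp: subring_set_def hom_distribs act_fract_emb h_invariant orbit_norm_invariant\<close>)
  then show ?thesis using assms(2) by blast
qed

section \<open>Orbits of the coordinates under stabilizers\<close>

lemma span_fixed:
  assumes g: "g \<in> G" and stab: "\<And>i. 1 \<le> i \<Longrightarrow> i < s \<Longrightarrow> act g (Var i) = Var i" and "r < s" "u \<in> span r"
  shows "act_fract g u = u"
proof -
  interpret \<sigma>: comm_ring_hom "act_fract g" by (rule act_ring_hom[OF g])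
  show ?thesis using \<open>u \<in> span r\<close>
  proof (induction rule: span_set_induct)
    case (gen c i)
    then show ?case using stab[of i] \<open>r < s\<close> by (simp add: hom_distribs act_fract_emb g) (simp add: coord_def act_hom(2) g)
  qed (simp_all add: hom_distribs)
qed

text \<open>Root elements realize the translations by c x_j. Composing two stabilizing elements adds
  their translations, because the outer one fixes the translation vector of the inner one.\<close>

lemma stabilizer_orbit:
  assumes s: "1 \<le> s" "s \<le> n" and u: "u \<in> span (min (s - 1) (n - s))"
  shows "\<exists>g\<in>G. (\<forall>i. 1 \<le> i \<longrightarrow> i < s \<longrightarrow> act g (Var i) = Var i) \<and> act_fract g (coord s) = coord s + u"
proof -
  let ?d = "min (s - 1) (n - s)"
  \<comment> \<open>Membership in the span is carried through the induction, since the addition step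
    needs it to see that \<open>v\<close> is fixed by \<open>g\<close>.\<close>
  have "u \<in> span ?d \<and> ?thesis" using u
  proof (induction rule: span_set_induct)
    case zero
    obtain g where "g \<in> G" "\<forall>f. act g f = f" using act_orth_one[of m a] unfolding G by blast
    then show ?case by (auto simp: coord_def act_hom(2) zero_in_span_set intro!: bexI[of _ g])
  next
    case (gen c j)
    have "j < s" "j + s < 2 * m + 3" using gen s n by auto
    then obtain M where M: "M \<in> orth_unitriangular m a" "\<And>i. 1 \<le> i \<Longrightarrow> i < s \<Longrightarrow> lin_var M i = Var i"
      "lin_var M s = Var s + Const c * Var j"
      using root_element_exists[of j s m a c] gen by blast
    obtain g where g: "g \<in> G" "act g = subst (lin_var M)" using lin_var_eq_act[OF M(1)] .
    then have "act_fract g (coord s) = coord s + emb c * coord j"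
      by (simp add: coord_def act_hom(2) M(3) emb_def)
    then show ?case using g M(2) gen
      by (auto intro!: bexI[of _ g] span_set_scale generator_in_span_set)
  next
    case (add u v)
    then obtain g g' where g: "g \<in> G" "\<And>i. 1 \<le> i \<Longrightarrow> i < s \<Longrightarrow> act g (Var i) = Var i" "act_fract g (coord s) = coord s + u"
      and g': "g' \<in> G" "\<And>i. 1 \<le> i \<Longrightarrow> i < s \<Longrightarrow> act g' (Var i) = Var i" "act_fract g' (coord s) = coord s + v"
      by blast
    interpret \<sigma>: comm_ring_hom "act_fract g" by (rule act_ring_hom[OF g(1)])
    obtain g'' where g'': "g'' \<in> G" "\<And>f. act g'' f = act g (act g' f)"
      using act_orth_comp[of g m a g'] g(1) g'(1) unfolding G by blast
    have "act_fract g'' (coord s) = act_fract g (act_fract g' (coord s))"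
      using g(1) g'(1) g'' by (simp add: coord_def act_hom(2))
    also have "\<dots> = coord s + u + act_fract g v" by (simp add: g' g hom_distribs)
    also have "act_fract g v = v"
      by (rule span_fixed[OF g(1,2), where s = s and r = ?d]) (use add s in auto)
    finally show ?case using g'' g g' add by (auto intro!: bexI[of _ g''] span_set_add simp: add.assoc)
  qed
  then show ?thesis ..
qed

text \<open>The orbit is the full coset x_i + span: \<open>orth_lin_var_form\<close> gives one
  inclusion and \<open>stabilizer_orbit\<close> the other.\<close>

lemma orbit_norm_eq_span_poly:
  assumes i: "1 \<le> i" "i \<le> m + 2"
  shows "to_fract (orbit_norm G i) = \<phi> (min (i - 1) m) (coord i)"
proof -
  let ?d = "min (i - 1) m"
  have d: "?d = min (i - 1) (n - i)" using i n by auto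
  have "(\<lambda>g. to_fract (act g (Var i))) ` G = (\<lambda>u. coord i + u) ` span ?d"
  proof (intro equalityI subsetI)
    fix z assume "z \<in> (\<lambda>g. to_fract (act g (Var i))) ` G"
    then obtain g where g: "g \<in> G" "z = to_fract (act g (Var i))" by blast
    obtain M where M: "M \<in> orth_unitriangular m a" "act g = subst (lin_var M)" using act_eq_lin_var[OF g(1)] .
    obtain e where "lin_var M i = Var i + (\<Sum>j = 1..?d. Const (e j) * Var j)"
      using orth_lin_var_form[OF M(1) two_a_neq_0 i] by blast
    then have "z = coord i + (\<Sum>j = 1..?d. emb (e j) * coord j)"
      by (simp add: g M coord_def emb_def)
    moreover have "(\<Sum>j = 1..?d. emb (e j) * coord j) \<in> span ?d"
      by (intro sum_in_span_set span_set_scale generator_in_span_set) auto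
    ultimately show "z \<in> (\<lambda>u. coord i + u) ` span ?d" by blast
  next
    fix z assume "z \<in> (\<lambda>u. coord i + u) ` span ?d"
    then obtain u where "z = coord i + u" "u \<in> span ?d" by blast
    then obtain g where "g \<in> G" "act_fract g (coord i) = z"
      using stabilizer_orbit[of i u] i n unfolding d by auto
    then show "z \<in> (\<lambda>g. to_fract (act g (Var i))) ` G" by (auto simp: coord_def act_hom(2))
  qed
  then have "to_fract (orbit_norm G i) = (\<Prod>u\<in>span ?d. coord i + u)"
    unfolding orbit_norm_eq_prod by (simp add: prod.reindex)
  also have "\<dots> = \<phi> ?d (coord i)"
    by (rule span_poly_eq_prod_add[symmetric]) (rule coord_notin_span_set)
  finally show ?thesis .
qed

lemma frobenius_bil_form:
  "bil_form m (emb a) u v ^ q ^ j = bil_form m (emb a) (\<lambda>i. u i ^ q ^ j) (\<lambda>i. v i ^ q ^ j)"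
proof -
  have "(2::'a mpoly fract) ^ q ^ j = 2"
    using embedding_power_q_iter[of "2::'a" j] by (simp add: hom_numeral)
  then show ?thesis
    by (simp only: bil_form_def frobenius_iter_add frobenius_iter_sum power_mult_distrib embedding_power_q_iter)
qed

text \<open>The value is the q^j-th power of the form at x and its Frobenius power of exponent l = k
  - j, which is 2 h_1 for l = 0 and h_{l+1} otherwise. The bound k < m keeps the index at most
  m.\<close>

lemma bil_form_powers_in_L:
  assumes "j \<le> k" "k < m"
  shows "bil_form m (emb a) (\<lambda>i. coord i ^ q ^ j) (\<lambda>i. coord i ^ q ^ k) \<in> L"
proof -
  note cl = subring_set_closed[OF L_closed(1)]
  define l where "l = k - j"
  have "bil_form m (emb a) coord (\<lambda>i. coord i ^ q ^ l) \<in> L"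
  proof (cases "l = 0")
    case True
    have "to_fract (h q m a 1) \<in> L" using assms by (intro L_closed(4)) auto
    then have "2 * to_fract (h q m a 1) \<in> L" by (intro cl(6) cl(10))
    then show ?thesis unfolding h_1_coord by (simp add: True)
  next
    case False
    have "l + 1 \<in> {1..m}" using assms by (auto simp: l_def)
    then have "to_fract (h q m a (l + 1)) \<in> L" by (intro L_closed(4)) blast
    then show ?thesis using h_coord[of "l + 1"] False by simp
  qed
  then have "bil_form m (emb a) coord (\<lambda>i. coord i ^ q ^ l) ^ q ^ j \<in> L" by (rule cl)
  moreover have "(coord i ^ q ^ l) ^ q ^ j = (coord i ^ q ^ k :: 'a mpoly fract)" for i
    using assms by (simp add: l_def flip: power_mult power_add)
  ultimately show ?thesis unfolding frobenius_bil_form by (simp only:)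
qed

text \<open>For \<open>s = 2m + 3 - r\<close> with \<open>r \<le> m\<close>, apply \<open>\<phi>\<^sub>r\<^sub>-\<^sub>1\<close> to every coordinate: the form takes a value that
  is polynomial in the \<open>h\<^sub>k\<close>, while \<open>\<phi>\<^sub>r\<^sub>-\<^sub>1\<close> kills \<open>x\<^sub>1, \<dots>, x\<^sub>r\<^sub>-\<^sub>1\<close>, so that \<open>2 N(x\<^sub>r) \<phi>\<^sub>r\<^sub>-\<^sub>1(x\<^sub>s)\<close> is the
  only term involving \<open>x\<^sub>s, x\<^sub>s\<^sub>+\<^sub>1, \<dots>\<close>.\<close>

lemma span_poly_coord_in_tower:
  assumes s: "1 \<le> s" "s \<le> n"
  shows "\<phi> (min (s - 1) (n - s)) (coord s) \<in> tower L (s - 1)"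
proof (cases "s \<le> m + 2")
  case True
  then have "to_fract (orbit_norm G s) \<in> L" using s by (intro L_closed(4)) auto
  moreover have "min (s - 1) (n - s) = min (s - 1) m" using True s n by auto
  ultimately show ?thesis
    using orbit_norm_eq_span_poly[OF s(1) True] tower_mono[OF L_closed(1), of 0 "s - 1"] by auto
next
  case False
  define r where "r = 2 * m + 3 - s"
  define A where "A = tower L (s - 1)"
  have r: "1 \<le> r" "r \<le> m" "s = 2 * m + 3 - r" "min (s - 1) (n - s) = r - 1" "r < s" "m + 2 < s"
    using False s n by (auto simp: r_def)
  have LA: "L \<subseteq> A" unfolding A_def using tower_mono[OF L_closed(1), of 0 "s - 1"] by simp
  have A: "subring_set A" unfolding A_def by (rule subring_set_tower[OF L_closed(1)])
  note cl = subring_set_closed[OF A]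
  have x: "coord i \<in> A" if "1 \<le> i" "i < s" for i
    unfolding A_def using that by (intro coord_in_tower L_closed(1)) auto
  obtain p where p: "\<And>j. p j \<in> A" "\<And>t. \<phi> (r - 1) t = (\<Sum>j\<le>r - 1. p j * t ^ q ^ j)"
    using span_poly_coeffs[OF A, of "r - 1" coord] x r by fastforce
  define w where "w i = \<phi> (r - 1) (coord i)" for i
  have wA: "w i \<in> A" if "1 \<le> i" "i < s" for i
    unfolding w_def p(2) using p(1) x[OF that] by (intro cl(6-8))
  have b: "bil_form m (emb a) (\<lambda>i. coord i ^ q ^ j) (\<lambda>i. coord i ^ q ^ k) \<in> A" if "j \<le> r - 1" "k \<le> r - 1" for j k
  proof (cases "j \<le> k")
    case True
    then show ?thesis using bil_form_powers_in_L[of j k] that r LA by auto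
  next
    case False
    then show ?thesis using bil_form_powers_in_L[of k j] that r LA by (subst bil_form_commute) auto
  qed
  \<comment> \<open>Expansion by bilinearity: the Frobenius exponents stay at most r - 1 < m, so
    only h_1, ..., h_m are involved.\<close>
  have "bil_form m (emb a) w w = (\<Sum>j\<le>r - 1. p j * (\<Sum>k\<le>r - 1. p k *
      bil_form m (emb a) (\<lambda>i. coord i ^ q ^ j) (\<lambda>i. coord i ^ q ^ k)))"
    unfolding w_def p(2) by (simp only: bil_form_sum_left bil_form_sum_right)
  also have "\<dots> \<in> A" using p(1) b by (intro cl(6,8)) auto
  finally have bw: "bil_form m (emb a) w w \<in> A" .
  let ?f = "\<lambda>i. w i * w (2 * m + 3 - i) + w (2 * m + 3 - i) * w i"
  \<comment> \<open>For i < r the factor \<open>w i\<close> vanishes; for i > r both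
    \<open>i\<close> and its partner are smaller than \<open>s\<close>.\<close>
  have rest: "?f i \<in> A" if "i \<in> {1..m + 1} - {r}" for i
  proof (cases "i < r")
    case True
    then have "w i = 0" unfolding w_def using that by (intro span_poly_generator) auto
    then show ?thesis using cl(1) by simp
  next
    case False
    then have "w i \<in> A" "w (2 * m + 3 - i) \<in> A" using that r by (auto intro!: wA)
    then show ?thesis using cl by auto
  qed
  have mid: "2 * w (m + 1) * w (m + 1) + 2 * emb a * w (m + 2) * w (m + 2) \<in> A"
    using r L_closed(3)[of a] LA by (intro cl(3) cl(6) cl(10) wA) auto
  define R where "R = sum ?f ({1..m + 1} - {r})"
  define Z where "Z = 2 * w (m + 1) * w (m + 1) + 2 * emb a * w (m + 2) * w (m + 2)"
  have "sum ?f {1..m + 1} = ?f r + R" unfolding R_def using r by (intro sum.remove) auto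
  then have "bil_form m (emb a) w w = ?f r + R + Z"
    unfolding bil_form_def sum_antidiagonal_halves Z_def by (simp only: add.assoc)
  then have "?f r = bil_form m (emb a) w w - Z - R" by (simp only: add_diff_cancel_right')
  also have "\<dots> \<in> A" using bw mid rest unfolding R_def Z_def by (intro cl(5) cl(8))
  finally have "?f r \<in> A" .
  then have "2 * w r * w s \<in> A"
    unfolding r(3)[symmetric] by (simp only: mult_2 distrib_right mult.commute[of "w s" "w r"])
  moreover have wr: "w r = to_fract (orbit_norm G r)"
  proof -
    have "min (r - 1) m = r - 1" using r(2) by simp
    then show ?thesis using orbit_norm_eq_span_poly[of r] r(1,2) unfolding w_def by simp
  qed
  \<comment> \<open>Membership in \<open>L\<close> itself matters: the ring \<open>A\<close> need
    not contain inverses of its elements, but the field \<open>L\<close> does.\<close>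
  then have "w r \<in> L" using r L_closed(4) by auto
  then have "inverse (2 * w r) \<in> A" using LA subring_set_closed(6,10)[OF L_closed(1)] L_closed(2) by blast
  ultimately have "inverse (2 * w r) * (2 * w r * w s) \<in> A" by (rule cl(6)[rotated])
  moreover have "w r \<noteq> 0"
    using span_poly_nonzero[of "r - 1" coord, OF coord_notin_span_set] r(1) by (simp add: w_def)
  then have "2 * w r \<noteq> 0" using two_mpoly_fract_neq_0 by simp
  then have "inverse (2 * w r) * (2 * w r * w s) = w s"
    by (simp only: mult.assoc[of "inverse (2 * w r)" "2 * w r" "w s", symmetric]
        left_inverse[OF \<open>2 * w r \<noteq> 0\<close>] mult_1_left)
  ultimately have "w s \<in> A" by (simp only:)
  then show ?thesis unfolding w_def r(4) A_def .
qed

text \<open>The monic polynomial for x_{s+1} has degree q^d, and the stabilizer of x_1, ..., x_s,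
  which fixes L[x_1, ..., x_s], moves x_{s+1} to at least q^d elements. So
  \<open>fixed_in_adjoin_descends\<close> applies.\<close>

lemma tower_descent:
  assumes f: "\<And>g. g \<in> G \<Longrightarrow> act_fract g f = f" and s: "s < n" and fs: "f \<in> tower L (Suc s)"
  shows "f \<in> tower L s"
proof -
  let ?d = "min s (n - Suc s)"
  define S where "S = act_fract ` {g \<in> G. \<forall>i. 1 \<le> i \<longrightarrow> i < Suc s \<longrightarrow> act g (Var i) = Var i}"
  note sub = subring_set_tower[OF L_closed(1), of s]
  obtain P where P: "degree P = q ^ ?d" "lead_coeff P = 1" "\<And>i. coeff P i \<in> tower L s" "poly P (coord (Suc s)) = 0"
    using span_poly_monic_root[OF sub, of ?d coord "coord (Suc s)"]
      span_poly_coord_in_tower[of "Suc s"] s coord_in_tower[OF L_closed(1), of _ s] by auto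
  show ?thesis
  proof (rule fixed_in_adjoin_descends[OF sub P(2-4), of f S "(\<lambda>u. coord (Suc s) + u) ` span ?d"])
    show "f \<in> adjoin (tower L s) (coord (Suc s))" using fs by simp
    show "comm_ring_hom \<sigma>" "\<sigma> f = f" if "\<sigma> \<in> S" for \<sigma>
      using that act_ring_hom f unfolding S_def by blast+
    show "\<sigma> x = x" if "\<sigma> \<in> S" "x \<in> tower L s" for \<sigma> x
    proof -
      obtain g where g: "g \<in> G" "\<sigma> = act_fract g" "\<And>i. 1 \<le> i \<Longrightarrow> i \<le> s \<Longrightarrow> act g (Var i) = Var i"
        using \<open>\<sigma> \<in> S\<close> unfolding S_def by auto
      show ?thesis unfolding g(2)
        by (rule hom_fixes_tower[OF act_ring_hom[OF g(1)] L_fixed[OF g(1)] _ that(2)])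
          (simp_all add: coord_def act_hom(2) g)
    qed
    show "finite ((\<lambda>u. coord (Suc s) + u) ` span ?d)" by (intro finite_imageI finite_span_set)
    show "(\<lambda>u. coord (Suc s) + u) ` span ?d \<subseteq> (\<lambda>\<sigma>. \<sigma> (coord (Suc s))) ` S"
    proof
      fix z assume "z \<in> (\<lambda>u. coord (Suc s) + u) ` span ?d"
      then obtain u where u: "z = coord (Suc s) + u" "u \<in> span ?d" by blast
      then obtain g where "g \<in> G" "\<forall>i. 1 \<le> i \<longrightarrow> i < Suc s \<longrightarrow> act g (Var i) = Var i" "z = act_fract g (coord (Suc s))"
        using stabilizer_orbit[of "Suc s" u] s by auto
      then show "z \<in> (\<lambda>\<sigma>. \<sigma> (coord (Suc s))) ` S" unfolding S_def by blast
    qed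
    show "degree P \<le> card ((\<lambda>u. coord (Suc s) + u) ` span ?d)"
      using card_span_set[of ?d coord, OF coord_notin_span_set] by (simp add: P(1) card_image)
  qed
qed

text \<open>The top of the tower contains every polynomial; n descents lead to its bottom, which is
  \<open>L\<close>.\<close>

lemma invariant_polynomial_in_L:
  assumes f: "f \<in> coord_ring n" and inv: "\<And>g. g \<in> G \<Longrightarrow> act_fract g (to_fract f) = to_fract f"
  shows "to_fract f \<in> L"
proof -
  have "to_fract f \<in> tower L (n - k)" if "k \<le> n" for k
    using that
  proof (induction k)
    case 0
    then show ?case using to_fract_in_tower[OF L_closed(1,3) f] by simp
  next
    case (Suc k)
    then show ?case using tower_descent[OF inv, of "n - Suc k"] by (simp add: Suc_diff_Suc)
  qed
  from this[of n] show ?thesis by simp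
qed

section \<open>From invariant polynomials to invariant fractions\<close>

lemma finite_orbit: "finite ((\<lambda>g. act g f) ` G)"
  unfolding G using finite_subset[OF _ finite_carrier_mat] orth_carrier by (intro finite_imageI) blast

lemma orbit_prod_in_coord_ring:
  assumes "f \<in> coord_ring n" shows "(\<Prod>y\<in>(\<lambda>g. act g f) ` G. y) \<in> coord_ring n"
  using act_orth_hom(3)[of _ m a f] assms unfolding G n
  by (intro subring_set_closed(9)[OF subring_set_coord_ring]) auto

text \<open>Multiplying numerator and denominator by the remaining conjugates of the denominator reduces
  the claim to invariant polynomials.\<close>

lemma invariant_field_subset: "invariant_field n G \<subseteq> L"
proof
  fix F assume "F \<in> invariant_field n G"
  then have F: "F \<in> fun_field n" "\<And>g. g \<in> G \<Longrightarrow> act_fract g F = F" by (auto simp: invariant_field_def)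
  then obtain f1 f2 where f: "F = Fract f1 f2" "f1 \<in> coord_ring n" "f2 \<in> coord_ring n" "f2 \<noteq> 0"
    unfolding fun_field_def by blast
  let ?O = "(\<lambda>g. act g f2) ` G"
  define B where "B = (\<Prod>y\<in>?O. y)"
  \<comment> \<open>The cofactor that turns the denominator \<open>f2\<close> into the invariant
    orbit product \<open>B\<close>. Since F and \<open>B\<close> are invariant, so is the new
    numerator.\<close>
  define B' where "B' = (\<Prod>y\<in>?O - {f2}. y)"
  have fin: "finite ?O" by (rule finite_orbit)
  have "f2 \<in> ?O" using act_orth_one[of m a] unfolding G by (metis image_eqI)
  then have B: "B = f2 * B'" unfolding B_def B'_def using fin by (simp add: prod.remove)
  have "act g f2 \<noteq> 0" if "g \<in> G" for g
    using act_orth_hom(2)[of g m a f2] that f(4) unfolding G by auto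
  then have B0: "B \<noteq> 0" unfolding B_def using fin by (auto simp: prod_zero_iff)
  have Bc: "B \<in> coord_ring n" unfolding B_def by (rule orbit_prod_in_coord_ring[OF f(3)])
  have B'c: "B' \<in> coord_ring n" unfolding B'_def
    using act_orth_hom(3)[of _ m a f2] f(3) unfolding G n
    by (intro subring_set_closed(9)[OF subring_set_coord_ring]) auto
  have Binv: "act_fract g (to_fract B) = to_fract B" if "g \<in> G" for g
    using act_orbit_prod_invariant[of g m a f2] that unfolding act_hom(2)[OF that] B_def G by simp
  have FB: "F * to_fract B = to_fract (f1 * B')"
    using f(4) by (simp add: f(1) B Fract_conv_to_fract)
  have "to_fract B \<in> L" by (rule invariant_polynomial_in_L[OF Bc Binv])
  moreover have "to_fract (f1 * B') \<in> L"
  proof (rule invariant_polynomial_in_L)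
    show "f1 * B' \<in> coord_ring n" using f(2) B'c by (rule subring_set_closed(6)[OF subring_set_coord_ring])
    fix g assume g: "g \<in> G"
    interpret \<sigma>: comm_ring_hom "act_fract g" by (rule act_ring_hom[OF g])
    show "act_fract g (to_fract (f1 * B')) = to_fract (f1 * B')"
      unfolding FB[symmetric] by (simp only: \<sigma>.hom_mult F(2)[OF g] Binv[OF g])
  qed
  ultimately have "to_fract (f1 * B') * inverse (to_fract B) \<in> L"
    using subring_set_closed(6)[OF L_closed(1)] L_closed(2) by blast
  moreover have "F = to_fract (f1 * B') * inverse (to_fract B)"
    unfolding FB[symmetric] using B0 by (simp add: mult.assoc)
  ultimately show "F \<in> L" by simp
qed

lemma h_in_coord_ring: "k \<in> {1..m} \<Longrightarrow> h q m a k \<in> coord_ring n"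
  unfolding h_def using subring_set_closed(10)[OF subring_set_coord_ring[of n], where w = "num.Bit0 num.One"]
  by (auto simp: n intro!: subring_set_closed(3,6,7,8)[OF subring_set_coord_ring] Var_in_coord_ring Const_in_coord_ring)

lemma L_subset: "L \<subseteq> invariant_field n G"
proof -
  have "L \<subseteq> fun_field n" unfolding L
  proof (rule field_gen_subset[OF subring_set_fun_field inverse_in_fun_field])
    show "emb c \<in> fun_field n" for c
      unfolding emb_def by (intro to_fract_in_fun_field Const_in_coord_ring)
    show "to_fract f \<in> fun_field n" if "f \<in> orbit_norm G ` {1..m + 2} \<union> h q m a ` {1..m}" for f
      using that h_in_coord_ring orbit_prod_in_coord_ring[OF Var_in_coord_ring, folded orbit_norm_def]
      by (intro to_fract_in_fun_field) (auto simp: n)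
  qed
  then show ?thesis using L_fixed by (auto simp: invariant_field_def)
qed

text \<open>For i = 1 the span is zero and \<phi> is the identity; this turns the first description
  of the generators into the second.\<close>

lemma orbit_norm_1: "orbit_norm G 1 = Var 1"
  using orbit_norm_eq_span_poly[of 1] by (simp add: coord_def)

end

theorem theorem4p20:
  fixes a :: "'a :: {field, finite}" and q m :: nat and G :: "'a mat set"
  assumes "q = CARD('a)" and "odd q" and "m \<ge> 1"
    and "irreducible [:a, 1, 1:]"
    and "G = orth_unitriangular m a"
  shows "invariant_field (2 * m + 2) G =
           field_gen (orbit_norm G ` {1..m + 2} \<union> h q m a ` {1..m}) \<and>
         invariant_field (2 * m + 2) G =
           field_gen ({Var 1} \<union> orbit_norm G ` {2..m + 2} \<union> h q m a ` {1..m})"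
proof -
  interpret minus_type a q m "2 * m + 2" G "field_gen (orbit_norm G ` {1..m + 2} \<union> h q m a ` {1..m})"
    by unfold_locales (use assms in auto)
  have "{1..m + 2} = insert 1 {2..m + 2}" by auto
  then have "orbit_norm G ` {1..m + 2} = {Var 1} \<union> orbit_norm G ` {2..m + 2}" by (auto simp: orbit_norm_1[simplified])
  then show ?thesis using invariant_field_subset L_subset by auto
qed

end
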